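(* Let $(\Omega,\mathcal{F},P)$ be a probability space, let $\mathfrak{Y}$ be a separable Banach space with topological dual $\mathfrak{Y}^*$, let $p\in[1,\infty)$ and $p'\in[p,\infty]$. Let $f:\mathfrak{Y}\times\Omega\to\mathbb{R}$ be a convex integrand and suppose that $F:\mathcal{L}_{p'}(\Omega,\mathcal{F},P;\mathfrak{Y})\to\mathcal{L}_p(\Omega,\mathcal{F},P)$ is given by $[F(x)](\omega)=f(x(\omega),\omega)$, $\omega\in\Omega$. Let $x\in\mathcal{L}_{p'}(\Omega,\mathcal{F},P;\mathfrak{Y})$, suppose that $f(\cdot,\omega)$ is convex and continuous at $x(\omega)$ for almost all $\omega\in\Omega$, and that $F$ is continuous at $x$. Further, suppose $\varrho:\mathcal{L}_p(\Omega,\mathcal{F},P)\to\mathbb{R}$ is convex and nondecreasing. Then the composite function $\varphi=\varrho\circ F$ is subdifferentiable at $x$ and $$\partial\varphi(x)=\bigcup_{\zeta\in\partial\varrho(F(x))}\big\{g\in\mathcal{L}_{q'}(\Omega,\mathcal{F},P;\mathfrak{Y}^* ):\ g(\omega)\in\zeta(\omega)\,\partial f(x(\omega),\omega)\ \text{a.s.}\big\},$$ where $1/p'+1/q'=1$.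
   Context: Equalities and inequalities between elements of $\mathcal{L}_p(\Omega,\mathcal{F},P)$ (real-valued functions) are understood almost surely. $1/\infty=0$. Convex integrand: a function $f:\mathfrak{Y}\times\Omega\to\mathbb{R}$ that is convex and continuous in the first argument for almost all values of the second argument, and measurable in the second argument for all values of the first argument. $\varrho$ is nondecreasing if $Z\le V$ a.s. implies $\varrho(Z)\le\varrho(V)$. $\partial f(y,\omega)\subset\mathfrak{Y}^*$ is the usual convex subdifferential of $f(\cdot,\omega)$ at $y$. $\partial\varrho(Z)$ is the usual convex subdifferential of $\varrho$ at $Z$, a subset of $\mathcal{L}_q(\Omega,\mathcal{F},P)$ with $1/p+1/q=1$, under the pairing $\langle\zeta,Z\rangle=\mathbb{E}[\zeta Z]$. $\partial\varphi(x)$ is the usual convex subdifferential, a subset of the topological dual of $\mathcal{L}_{p'}(\Omega,\mathcal{F},P;\mathfrak{Y})$; a function $g\in\mathcal{L}_{q'}(\Omega,\mathcal{F},P;\mathfrak{Y}^* )$ is identified with the continuous linear functional $h\mapsto\int_\Omega\langle g(\omega),h(\omega)\rangle\,P(d\omega)$. Subdifferentiable at $x$ means $\partial\varphi(x)\neq\emptyset$. $\mathcal{L}_{q'}(\Omega,\mathcal{F},P;\mathfrak{Y}^* )$ is the usual space of (classes of) measurable functions $g:\Omega\to\mathfrak{Y}^*$ with $\|g(\cdot)\|\in\mathcal{L}_{q'}(\Omega,\mathcal{F},P)$, and similarly for $\mathcal{L}_{p'}(\Omega,\mathcal{F},P;\mathfrak{Y})$.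
   Formalization: Measurability of g: Ω→Y* in L_{q'}(Ω,F,P;Y* ) is taken in the weak* sense (ω↦⟨g(ω),y⟩ measurable for every y); with norm measurability the formula fails for nonseparable Y*, e.g. Y=ℓ₁; the two notions agree when Y* is separable. *)

theory Defs
  imports "HOL-Probability.Probability"
begin

text \<open>
  Elements of the Lebesgue spaces are represented by functions, and equality of classes is equality
  almost everywhere. Exponents are of type \<^typ>\<open>ennreal\<close>, so that \<open>1 / \<infinity> = 0\<close> and
  \<open>1 / p + 1 / q = 1\<close> defines conjugate exponents, including the pair \<open>1\<close>, \<open>\<infinity>\<close>.
\<close>

definition Lp_space :: "'a measure \<Rightarrow> ennreal \<Rightarrow> ('a \<Rightarrow> 'b::real_normed_vector) set" where
  "Lp_space M p = {x \<in> borel_measurable M.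
     if p = \<infinity> then esssup M (\<lambda>\<omega>. ereal (norm (x \<omega>))) < \<infinity>
     else integrable M (\<lambda>\<omega>. norm (x \<omega>) powr enn2real p)}"

definition Lp_norm :: "'a measure \<Rightarrow> ennreal \<Rightarrow> ('a \<Rightarrow> 'b::real_normed_vector) \<Rightarrow> real" where
  "Lp_norm M p x =
     (if p = \<infinity> then real_of_ereal (esssup M (\<lambda>\<omega>. ereal (norm (x \<omega>))))
      else (\<integral>\<omega>. norm (x \<omega>) powr enn2real p \<partial>M) powr (1 / enn2real p))"

text \<open>
  The space of functions with values in the dual of \<^typ>\<open>'b\<close>. When the dual is not separable,
  measurability has to be understood with respect to the weak* topology (for separable \<^typ>\<open>'b\<close>
  its Borel sets are generated by the evaluations): strongly measurable functions do not
  represent all the functionals arising as subgradients.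
\<close>

definition Lp_space_dual_valued ::
  "'a measure \<Rightarrow> ennreal \<Rightarrow> ('a \<Rightarrow> ('b::real_normed_vector \<Rightarrow>\<^sub>L real)) set" where
  "Lp_space_dual_valued M q = {g.
     (\<forall>y. (\<lambda>\<omega>. blinfun_apply (g \<omega>) y) \<in> borel_measurable M) \<and>
     (\<lambda>\<omega>. norm (g \<omega>)) \<in> Lp_space M q}"

text \<open>
  Functionals are \<^const>\<open>extensional\<close>, so that equality of functionals is equality on \<open>Lp_space M p\<close>.
  Boundedness by the seminorm makes them respect equality almost everywhere.
\<close>

definition Lp_dual :: "'a measure \<Rightarrow> ennreal \<Rightarrow> (('a \<Rightarrow> 'b::real_normed_vector) \<Rightarrow> real) set" where
  "Lp_dual M p = {l \<in> extensional (Lp_space M p).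
     (\<forall>h\<in>Lp_space M p. \<forall>k\<in>Lp_space M p. l (\<lambda>\<omega>. h \<omega> + k \<omega>) = l h + l k) \<and>
     (\<forall>c. \<forall>h\<in>Lp_space M p. l (\<lambda>\<omega>. c *\<^sub>R h \<omega>) = c * l h) \<and>
     (\<exists>K. \<forall>h\<in>Lp_space M p. \<bar>l h\<bar> \<le> K * Lp_norm M p h)}"

definition Lp_functional ::
  "'a measure \<Rightarrow> ennreal \<Rightarrow> ('a \<Rightarrow> ('b::real_normed_vector \<Rightarrow>\<^sub>L real)) \<Rightarrow> ('a \<Rightarrow> 'b) \<Rightarrow> real" where
  "Lp_functional M p g = (\<lambda>h\<in>Lp_space M p. \<integral>\<omega>. blinfun_apply (g \<omega>) (h \<omega>) \<partial>M)"

definition Lp_continuous_at ::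
  "'a measure \<Rightarrow> ennreal \<Rightarrow> ennreal \<Rightarrow>
   (('a \<Rightarrow> 'b::real_normed_vector) \<Rightarrow> ('a \<Rightarrow> 'c::real_normed_vector)) \<Rightarrow> ('a \<Rightarrow> 'b) \<Rightarrow> bool" where
  "Lp_continuous_at M r s F x \<longleftrightarrow>
     (\<forall>\<epsilon>>0. \<exists>\<delta>>0. \<forall>h\<in>Lp_space M r.
        Lp_norm M r (\<lambda>\<omega>. h \<omega> - x \<omega>) < \<delta> \<longrightarrow> Lp_norm M s (\<lambda>\<omega>. F h \<omega> - F x \<omega>) < \<epsilon>)"

definition Lp_convex :: "'a measure \<Rightarrow> ennreal \<Rightarrow> (('a \<Rightarrow> real) \<Rightarrow> real) \<Rightarrow> bool" where
  "Lp_convex M p \<rho> \<longleftrightarrow>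
     (\<forall>Z\<in>Lp_space M p. \<forall>V\<in>Lp_space M p. \<forall>t\<in>{0..1}.
        \<rho> (\<lambda>\<omega>. (1 - t) * Z \<omega> + t * V \<omega>) \<le> (1 - t) * \<rho> Z + t * \<rho> V)"

definition Lp_nondecreasing :: "'a measure \<Rightarrow> ennreal \<Rightarrow> (('a \<Rightarrow> real) \<Rightarrow> real) \<Rightarrow> bool" where
  "Lp_nondecreasing M p \<rho> \<longleftrightarrow>
     (\<forall>Z\<in>Lp_space M p. \<forall>V\<in>Lp_space M p. (AE \<omega> in M. Z \<omega> \<le> V \<omega>) \<longrightarrow> \<rho> Z \<le> \<rho> V)"

definition convex_integrand :: "'a measure \<Rightarrow> ('b::real_normed_vector \<Rightarrow> 'a \<Rightarrow> real) \<Rightarrow> bool" where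
  "convex_integrand M f \<longleftrightarrow>
     (AE \<omega> in M. convex_on UNIV (\<lambda>y. f y \<omega>) \<and> continuous_on UNIV (\<lambda>y. f y \<omega>)) \<and>
     (\<forall>y. (\<lambda>\<omega>. f y \<omega>) \<in> borel_measurable M)"

definition subdifferential :: "('b::real_normed_vector \<Rightarrow> real) \<Rightarrow> 'b \<Rightarrow> ('b \<Rightarrow>\<^sub>L real) set" where
  "subdifferential h y = {v. \<forall>z. h z \<ge> h y + blinfun_apply v (z - y)}"

definition Lp_subdifferential ::
  "'a measure \<Rightarrow> ennreal \<Rightarrow> (('a \<Rightarrow> 'b::real_normed_vector) \<Rightarrow> real) \<Rightarrow> ('a \<Rightarrow> 'b) \<Rightarrow>
   (('a \<Rightarrow> 'b) \<Rightarrow> real) set" where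
  "Lp_subdifferential M p \<phi> x =
     {l \<in> Lp_dual M p. \<forall>h\<in>Lp_space M p. \<phi> h \<ge> \<phi> x + l (\<lambda>\<omega>. h \<omega> - x \<omega>)}"

text \<open>
  The subdifferential of a function on \<open>Lp_space M p\<close> under the pairing with \<open>Lp_space M q\<close>,
  \<open>q\<close> being the exponent conjugate to \<open>p\<close>.
\<close>

definition Lp_subdifferential_pairing ::
  "'a measure \<Rightarrow> ennreal \<Rightarrow> ennreal \<Rightarrow> (('a \<Rightarrow> real) \<Rightarrow> real) \<Rightarrow> ('a \<Rightarrow> real) \<Rightarrow> ('a \<Rightarrow> real) set" where
  "Lp_subdifferential_pairing M p q \<rho> Z =
     {\<zeta> \<in> Lp_space M q. \<forall>V\<in>Lp_space M p. \<rho> V \<ge> \<rho> Z + (\<integral>\<omega>. \<zeta> \<omega> * (V \<omega> - Z \<omega>) \<partial>M)}"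

end

theory Submission
  imports Defs "HOL-Library.Function_Algebras"
begin

text \<open>
  One inclusion is a direct computation: if \<open>\<zeta>\<close> is a subgradient of \<open>\<rho>\<close> at \<open>F x\<close>, then \<open>\<zeta> \<ge> 0\<close> because \<open>\<rho>\<close> is
  nondecreasing, and a function \<open>g\<close> with \<open>g \<omega> \<in> \<zeta> \<omega> \<partial>f(x \<omega>, \<omega>)\<close> yields a subgradient of the composition
  by integrating pointwise inequalities (\<open>pairing_product_subgradient\<close>).

  For the other inclusion, let \<open>l\<close> be a linear functional that supports \<open>\<rho> \<circ> F\<close> at \<open>x\<close>. The argument has
  two parts.

  First, \<open>l\<close> is scalarized. The perturbation function
  \<open>\<Psi> V = (INF h. \<rho> (F h + V) - l (h - x))\<close> is convex and finite, with value \<open>\<rho> (F x)\<close> at \<open>V = 0\<close>. A linear support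
  of it at \<open>0\<close> is at the same time a subgradient of \<open>\<rho>\<close> at \<open>F x\<close> and a multiplier: it is a positive functional,
  hence given by some \<open>\<zeta> \<ge> 0\<close> in the conjugate Lebesgue space, and
  \<open>l (h - x) \<le> \<integral>\<omega>. \<zeta> \<omega> * (F h \<omega> - F x \<omega>) \<partial>M\<close> for all \<open>h\<close> (\<open>monotone_composition_multiplier\<close>). Positive linear
  functionals on a Lebesgue space with finite exponent are bounded
  (\<open>monotone_homogeneous_Lp_bounded\<close>), which is where the continuity of the multiplier comes from.

  Second, \<open>l\<close> is localized (\<open>dominated_functional.representation\<close>). Cutting \<open>h\<close> off outside an event \<open>A\<close> turns the
  inequality into one between set functions, so \<open>A \<mapsto> l (1\<^sub>A h)\<close> is absolutely continuous with a density
  that depends linearly on \<open>h\<close> and is bounded above by \<open>\<zeta> \<omega> * (f (x \<omega> + h \<omega>) \<omega> - f (x \<omega>) \<omega>)\<close>. For constant \<open>h\<close> from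
  a countable dense set, the densities define almost surely a continuous linear functional \<open>g \<omega>\<close> with
  \<open>g \<omega> \<in> \<zeta> \<omega> \<partial>f(x \<omega>, \<omega>)\<close>, and by continuity of \<open>f\<close> the density of a general \<open>h\<close> is \<open>g \<omega> (h \<omega>)\<close>. Thus \<open>l\<close> is the
  integral functional of \<open>g\<close>. That \<open>norm (g \<omega>)\<close> has the conjugate integrability is the converse of the
  inequality of Hoelder, tested along a measurable selection of nearly norming vectors.

  Boundedness of \<open>l\<close> is a conclusion of the second part. Hence the Hahn--Banach theorem for convex functions,
  in its algebraic form (\<open>convex_on_linear_support\<close>), already provides an element of the subdifferential.
\<close>

section \<open>Linear supports of convex functions\<close>

text \<open>
  The Lebesgue spaces of functions are treated as subspaces of the full space of functions, so that
  the algebraic support theorem below applies to them and to a Banach space alike.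
\<close>
instantiation "fun" :: (type, real_vector) real_vector
begin
definition scaleR_fun_def: "c *\<^sub>R f = (\<lambda>x. c *\<^sub>R f x)"
instance
  by standard (simp_all add: fun_eq_iff scaleR_fun_def scaleR_add_right scaleR_add_left)
end

lemma scaleR_fun_apply [simp]: "(c *\<^sub>R f) x = c *\<^sub>R f x"
  by (simp add: scaleR_fun_def)

text \<open>
  The two infima are independent, so the minimizing arguments may be chosen one after the other;
  this is the step that makes an infimum of convex functions over a directed or jointly convex
  family convex.
\<close>
lemma le_convex_combination_INF:
  fixes a :: "'u \<Rightarrow> real" and b :: "'v \<Rightarrow> real"
  assumes le: "\<And>u v. u \<in> A \<Longrightarrow> v \<in> B \<Longrightarrow> c \<le> (1 - t) * a u + t * b v"
    and t: "0 < t" "t < 1" and ne: "A \<noteq> {}" "B \<noteq> {}"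
  shows "c \<le> (1 - t) * (INF u\<in>A. a u) + t * (INF v\<in>B. b v)"
proof -
  have *: "c \<le> (1 - t) * a u + t * (INF v\<in>B. b v)" if "u \<in> A" for u
  proof -
    have "(c - (1 - t) * a u) / t \<le> (INF v\<in>B. b v)"
      using le[OF that] t by (intro cINF_greatest ne) (simp add: field_simps)
    then show ?thesis using t by (simp add: field_simps)
  qed
  have "(c - t * (INF v\<in>B. b v)) / (1 - t) \<le> (INF u\<in>A. a u)"
    using * t by (intro cINF_greatest ne) (simp add: field_simps)
  then show ?thesis using t by (simp add: field_simps)
qed

text \<open>
  Geometrically, the epigraph of the marginal function is essentially the projection of the epigraph
  of \<open>J\<close>, and projections of convex sets are convex.
\<close>
lemma convex_on_INF_marginal:
  fixes J :: "'u::real_vector \<times> 'v::real_vector \<Rightarrow> real"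
  assumes J: "convex_on (S \<times> T) J" and S: "S \<noteq> {}" "convex S" and T: "convex T"
    and bdd: "\<And>v. v \<in> T \<Longrightarrow> bdd_below ((\<lambda>u. J (u, v)) ` S)"
  shows "convex_on T (\<lambda>v. INF u\<in>S. J (u, v))"
proof (rule convex_onI[OF _ T])
  fix t :: real and v w assume t: "0 < t" "t < 1" and vw: "v \<in> T" "w \<in> T"
  let ?I = "\<lambda>v. INF u\<in>S. J (u, v)"
  let ?z = "(1 - t) *\<^sub>R v + t *\<^sub>R w"
  have z: "?z \<in> T" using convexD[OF T vw, of "1-t" t] t by simp
  have *: "?I ?z \<le> (1 - t) * J (u1, v) + t * J (u2, w)" if u: "u1 \<in> S" "u2 \<in> S" for u1 u2
  proof -
    let ?u = "(1 - t) *\<^sub>R u1 + t *\<^sub>R u2"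
    have "?u \<in> S" using convexD[OF S(2) u, of "1-t" t] t by simp
    then have "?I ?z \<le> J (?u, ?z)" by (intro cINF_lower bdd z)
    also have "(?u, ?z) = (1 - t) *\<^sub>R (u1, v) + t *\<^sub>R (u2, w)" by simp
    also have "J \<dots> \<le> (1 - t) * J (u1, v) + t * J (u2, w)"
      using convex_onD[OF J, of t "(u1, v)" "(u2, w)"] t u vw by simp
    finally show ?thesis .
  qed
  show "?I ?z \<le> (1 - t) * ?I v + t * ?I w"
    using * t S by (intro le_convex_combination_INF) auto
qed

lemma convex_on_neg_le:
  assumes "convex_on UNIV q" "q 0 = (0::real)"
  shows "- q (- v) \<le> q v"
proof -
  have "(1/2) *\<^sub>R v + (1/2) *\<^sub>R (- v) = 0" by simp
  then show ?thesis using convex_onD[OF assms(1), of "1/2" v "- v"] assms(2) by simp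
qed

text \<open>
  Zorn's lemma applies because every convex \<open>q\<close> with \<open>q 0 = 0\<close> and \<open>q \<le> \<Psi>\<close> satisfies
  \<open>q v \<ge> - q (- v) \<ge> - \<Psi> (- v)\<close>: this bound does not depend on \<open>q\<close>, so the pointwise infimum of a
  chain is finite.
\<close>
lemma minimal_convex_minorant:
  fixes \<Psi> :: "'v::real_vector \<Rightarrow> real"
  assumes \<Psi>: "convex_on UNIV \<Psi>" "\<Psi> 0 = 0"
  obtains m where "convex_on UNIV m" "m 0 = 0" "m \<le> \<Psi>"
    "\<And>q. convex_on UNIV q \<Longrightarrow> q 0 = 0 \<Longrightarrow> q \<le> m \<Longrightarrow> q = m"
proof -
  define A where "A = {q. convex_on UNIV q \<and> q 0 = 0 \<and> q \<le> \<Psi>}"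
  let ?P = "\<lambda>q r :: 'v \<Rightarrow> real. r \<le> q"
  have "\<exists>m\<in>A. \<forall>a\<in>A. ?P m a \<longrightarrow> a = m"
  proof (rule predicate_Zorn)
    show "partial_order_on A (relation_of ?P A)"
      by (rule partial_order_on_relation_ofI) (auto intro: order_trans antisym)
  next
    fix C assume C: "C \<in> Chains (relation_of ?P A)"
    then have CA: "C \<subseteq> A" and tot: "\<And>q r. q \<in> C \<Longrightarrow> r \<in> C \<Longrightarrow> q \<le> r \<or> r \<le> q"
      unfolding Chains_def relation_of_def by auto
    show "\<exists>u\<in>A. \<forall>a\<in>C. ?P a u"
    proof (cases "C = {}")
      case True
      then show ?thesis using \<Psi> by (auto simp: A_def)
    next
      case False
      have bdd: "bdd_below ((\<lambda>q. q v) ` C)" for v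
      proof (rule bdd_belowI2)
        fix q assume "q \<in> C"
        then have "convex_on UNIV q" "q 0 = 0" "q (- v) \<le> \<Psi> (- v)"
          using CA by (auto simp: A_def le_fun_def)
        then show "- \<Psi> (- v) \<le> q v"
          using convex_on_neg_le[of q v] by linarith
      qed
      define u where "u = (\<lambda>v. INF q\<in>C. q v)"
      have uq: "u v \<le> q v" if "q \<in> C" for q v
        unfolding u_def using that by (intro cINF_lower bdd)
      have "convex_on UNIV u"
      proof (rule convex_onI)
        fix t :: real and v w :: 'v assume t: "0 < t" "t < 1"
        let ?z = "(1 - t) *\<^sub>R v + t *\<^sub>R w"
        have *: "u ?z \<le> (1 - t) * q v + t * r w" if qr: "q \<in> C" "r \<in> C" for q r
        proof -
          obtain s where s: "s \<in> C" "s v \<le> q v" "s w \<le> r w"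
            using tot[OF qr] qr by (auto simp: le_fun_def)
          have "u ?z \<le> s ?z" by (rule uq) fact
          also have "\<dots> \<le> (1 - t) * s v + t * s w"
            using s CA t by (intro convex_onD) (auto simp: A_def)
          also have "\<dots> \<le> (1 - t) * q v + t * r w"
            using s t by (intro add_mono mult_left_mono) auto
          finally show ?thesis .
        qed
        show "u ?z \<le> (1 - t) * u v + t * u w"
          unfolding u_def[THEN fun_cong, of v] u_def[THEN fun_cong, of w]
          using * t False by (intro le_convex_combination_INF) auto
      qed simp
      moreover have "u 0 = 0"
      proof -
        have "u 0 = (INF q\<in>C. 0)" unfolding u_def using CA by (intro INF_cong) (auto simp: A_def)
        then show ?thesis using False by simp
      qed
      moreover have "u \<le> \<Psi>"
      proof -
        obtain q where "q \<in> C" using False by auto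
        then show ?thesis using uq[of q] CA by (force simp: A_def le_fun_def intro: order_trans)
      qed
      ultimately show ?thesis using uq by (auto simp: A_def le_fun_def)
    qed
  qed
  then show ?thesis using that by (auto simp: A_def intro: order_trans)
qed

text \<open>
  Each half of linearity comes from a convex function that lies below \<open>m\<close> and therefore equals it:
  \<open>v \<mapsto> m (s v) / s\<close> with \<open>0 < s \<le> 1\<close> gives positive homogeneity, and the infimum over \<open>t \<ge> 0\<close> of
  \<open>m (v + t y) - t m y\<close>, whose value at \<open>t = 1\<close> is an upper bound, gives superadditivity.
\<close>
lemma minimal_convex_linear:
  fixes m :: "'v::real_vector \<Rightarrow> real"
  assumes m: "convex_on UNIV m" "m 0 = 0"
    and min: "\<And>q. convex_on UNIV q \<Longrightarrow> q 0 = 0 \<Longrightarrow> q \<le> m \<Longrightarrow> q = m"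
  shows "linear m"
proof -
  have hom1: "m (s *\<^sub>R v) = s * m v" if s: "0 < s" "s \<le> 1" for s v
  proof -
    define q where "q = (\<lambda>v. m (s *\<^sub>R v) / s)"
    have "convex_on UNIV q"
    proof (rule convex_onI)
      fix t :: real and v w :: 'v assume "0 < t" "t < 1"
      then have "m ((1 - t) *\<^sub>R (s *\<^sub>R v) + t *\<^sub>R (s *\<^sub>R w)) \<le> (1 - t) * m (s *\<^sub>R v) + t * m (s *\<^sub>R w)"
        by (intro convex_onD[OF m(1)]) auto
      then show "q ((1 - t) *\<^sub>R v + t *\<^sub>R w) \<le> (1 - t) * q v + t * q w"
        using s by (simp add: q_def field_simps scaleR_add_right)
    qed simp
    moreover have "q \<le> m"
    proof (rule le_funI)
      fix v show "q v \<le> m v"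
        using convex_onD[OF m(1), of s 0 v] s by (simp add: q_def m(2) field_simps)
    qed
    ultimately have "q = m" by (intro min) (auto simp: q_def m)
    then show ?thesis using s by (auto simp: q_def fun_eq_iff field_simps)
  qed
  have hom: "m (s *\<^sub>R v) = s * m v" if s: "0 \<le> s" for s v
  proof -
    consider "s = 0" | "0 < s" "s \<le> 1" | "s > 1" using s by linarith
    then show ?thesis
    proof cases
      case 3
      then show ?thesis using hom1[of "1/s" "s *\<^sub>R v"] by (simp add: field_simps)
    qed (auto simp: m hom1)
  qed
  have sub: "m (v + w) \<le> m v + m w" for v w
    using convex_onD[OF m(1), of "1/2" "2 *\<^sub>R v" "2 *\<^sub>R w"] by (simp add: hom)
  have super: "m v + m y \<le> m (v + y)" for v y
  proof -
    define J where "J = (\<lambda>(t, v). m (v + t *\<^sub>R y) - t * m y)"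
    have bdd: "bdd_below ((\<lambda>t. J (t, v)) ` {0..})" for v
    proof (rule bdd_belowI2)
      fix t :: real assume "t \<in> {0..}"
      then show "- m (- v) \<le> J (t, v)"
        using sub[of "v + t *\<^sub>R y" "- v"] hom[of t y] by (simp add: J_def)
    qed
    have "convex_on ({0..} \<times> UNIV) J"
    proof (rule convex_onI)
      fix t :: real and z w :: "real \<times> 'v" assume t: "0 < t" "t < 1" 
      obtain a v where z: "z = (a, v)" by fastforce
      obtain b u where w: "w = (b, u)" by fastforce
      have "m ((1 - t) *\<^sub>R (v + a *\<^sub>R y) + t *\<^sub>R (u + b *\<^sub>R y))
          \<le> (1 - t) * m (v + a *\<^sub>R y) + t * m (u + b *\<^sub>R y)"
        using t by (intro convex_onD[OF m(1)]) auto
      then show "J ((1 - t) *\<^sub>R z + t *\<^sub>R w) \<le> (1 - t) * J z + t * J w"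
        by (simp add: J_def z w algebra_simps)
    qed (simp add: convex_Times)
    then have "convex_on UNIV (\<lambda>v. INF t\<in>{0..}. J (t, v))"
      by (intro convex_on_INF_marginal bdd) auto
    moreover have "(\<lambda>v. INF t\<in>{0..}. J (t, v)) \<le> m"
    proof (rule le_funI)
      fix v show "(INF t\<in>{0..}. J (t, v)) \<le> m v"
        using cINF_lower[OF bdd, of 0 v] by (simp add: J_def)
    qed
    moreover have "(INF t\<in>{0..}. J (t, 0)) = 0"
    proof -
      have "(INF t\<in>{0::real..}. J (t, 0)) = (INF t\<in>{0::real..}. 0)"
        by (intro INF_cong) (auto simp: J_def hom)
      then show ?thesis by simp
    qed
    ultimately have "(\<lambda>v. INF t\<in>{0..}. J (t, v)) = m" by (intro min)
    then have "m v \<le> J (1, v)"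
      using cINF_lower[OF bdd, of 1 v] by (auto simp: fun_eq_iff)
    then show ?thesis by (simp add: J_def)
  qed
  have add: "m (v + w) = m v + m w" for v w
    using sub super by (intro antisym) 
  have neg: "m (- v) = - m v" for v
    using add[of v "- v"] m(2) by simp
  have "m (s *\<^sub>R v) = s * m v" for s v
    using hom[of s v] hom[of "- s" v] neg[of "s *\<^sub>R v"] by (cases "0 \<le> s") auto
  then show ?thesis using add by (intro linearI) auto
qed

text \<open>
  The algebraic Hahn--Banach theorem in the form of a support functional. Composing with a linear
  projection onto \<open>S\<close> extends the function to the whole space, where a minimal convex minorant
  of the increment \<open>v \<mapsto> \<Psi> (x + v) - \<Psi> x\<close> is linear. Continuity of the functionals found in
  this way follows later, from positivity or from a continuous upper bound.
\<close>
theorem convex_on_linear_support: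
  fixes \<Psi> :: "'v::real_vector \<Rightarrow> real"
  assumes \<Psi>: "convex_on S \<Psi>" and S: "subspace S" and x: "x \<in> S"
  obtains l where "linear l" "\<And>h. h \<in> S \<Longrightarrow> \<Psi> x + l (h - x) \<le> \<Psi> h"
proof -
  have "linear (id :: 'v \<Rightarrow> 'v)" by (rule linear_id)
  from linear_exists_left_inverse_on[OF this S] obtain P
    where P: "range P \<subseteq> S" "linear P" "\<And>v. v \<in> S \<Longrightarrow> P v = v" by auto
  interpret P: linear P by fact
  define q where "q = (\<lambda>v. \<Psi> (x + P v) - \<Psi> x)"
  have "convex_on UNIV q"
  proof (rule convex_onI)
    fix t :: real and v w :: 'v assume t: "0 < t" "t < 1"
    have "x + P v \<in> S" "x + P w \<in> S"
      using P(1) x by (auto intro!: subspace_add[OF S])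
    then have "\<Psi> ((1 - t) *\<^sub>R (x + P v) + t *\<^sub>R (x + P w)) \<le> (1 - t) * \<Psi> (x + P v) + t * \<Psi> (x + P w)"
      using t by (intro convex_onD[OF \<Psi>]) auto
    then show "q ((1 - t) *\<^sub>R v + t *\<^sub>R w) \<le> (1 - t) * q v + t * q w"
      by (simp add: q_def P.add P.diff P.scale algebra_simps)
  qed simp
  then obtain m where m: "convex_on UNIV m" "m 0 = 0" "m \<le> q"
    "\<And>r. convex_on UNIV r \<Longrightarrow> r 0 = 0 \<Longrightarrow> r \<le> m \<Longrightarrow> r = m"
    by (rule minimal_convex_minorant) (auto simp: q_def P.zero)
  have "linear m" using m by (intro minimal_convex_linear)
  moreover have "\<Psi> x + m (h - x) \<le> \<Psi> h" if h: "h \<in> S" for h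
  proof -
    have "m (h - x) \<le> \<Psi> (x + P (h - x)) - \<Psi> x" using m(3) by (auto simp: q_def le_fun_def)
    then show ?thesis using subspace_diff[OF S h x] P(3) by simp
  qed
  ultimately show ?thesis using that by blast
qed

section \<open>Lebesgue spaces\<close>
lemma conjugate_exponent_cases:
  fixes p q :: ennreal
  assumes p1: "1 \<le> p" and pq: "1 / p + 1 / q = 1"
  obtains (one) "p = 1" "q = \<infinity>"
    | (top) "p = \<infinity>" "q = 1"
    | (real) r s where "p = ennreal r" "q = ennreal s" "1 < r" "1 < s" "1 / r + 1 / s = 1"
proof (cases p)
  case top
  then have "1 / q = 1" using pq by simp
  then have "q = 1" by (simp add: divide_eq_1_ennreal)
  then show ?thesis using top by (intro that(2)) simp_all
next
  case (real r)
  have r: "1 \<le> r" using p1 real(2) by simp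
  have ip: "1 / p = ennreal (1 / r)" using real r divide_ennreal[of 1 r] by simp
  show ?thesis
  proof (cases q)
    case top
    then have "ennreal (1 / r) = 1" using pq ip by simp
    then have "r = 1" using r by (simp add: ennreal_eq_1)
    then show ?thesis using real top by (intro that(1)) simp_all
  next
    case q: (real s)
    have "s \<noteq> 0"
    proof
      assume "s = 0"
      then show False using q pq by (simp add: divide_ennreal_def)
    qed
    then have s: "0 < s" using q by simp
    then have iq: "1 / q = ennreal (1 / s)" using q divide_ennreal[of 1 s] by simp
    have "ennreal (1 / r + 1 / s) = ennreal 1" using pq r s by (subst ennreal_plus) (auto simp: ip iq)
    then have e: "1 / r + 1 / s = 1" using r s by (subst (asm) ennreal_inj) auto
    have "0 < 1 / r" "0 < 1 / s" using r s by auto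
    with e have "1 / r < 1" "1 / s < 1" by linarith+
    then have "1 < r" "1 < s" using r s by (simp_all only: divide_less_eq_1_pos)
    with real(2) q(2) e show ?thesis by (intro that(3))
  qed
qed

lemma Lp_space_measurable: "x \<in> Lp_space M p \<Longrightarrow> x \<in> borel_measurable M"
  by (simp add: Lp_space_def)

lemma Lp_space_ennreal_iff:
  "0 \<le> r \<Longrightarrow> x \<in> Lp_space M (ennreal r) \<longleftrightarrow>
     x \<in> borel_measurable M \<and> integrable M (\<lambda>\<omega>. norm (x \<omega>) powr r)"
  by (simp add: Lp_space_def)

lemma Lp_norm_ennreal: "0 \<le> r \<Longrightarrow> Lp_norm M (ennreal r) x = (\<integral>\<omega>. norm (x \<omega>) powr r \<partial>M) powr (1 / r)"
  by (simp add: Lp_norm_def)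

lemma Lp_space_top_iff:
  "x \<in> Lp_space M \<infinity> \<longleftrightarrow> x \<in> borel_measurable M \<and> (\<exists>C. AE \<omega> in M. norm (x \<omega>) \<le> C)"
proof (intro iffI conjI; (elim conjE exE)?)
  assume x: "x \<in> Lp_space M \<infinity>"
  then show [measurable]: "x \<in> borel_measurable M" by (rule Lp_space_measurable)
  have "esssup M (\<lambda>\<omega>. ereal (norm (x \<omega>))) < \<infinity>" using x by (simp add: Lp_space_def)
  then obtain C where C: "esssup M (\<lambda>\<omega>. ereal (norm (x \<omega>))) \<le> ereal C"
    by (cases "esssup M (\<lambda>\<omega>. ereal (norm (x \<omega>)))") auto
  from esssup_AE[of "\<lambda>\<omega>. ereal (norm (x \<omega>))" M] have "AE \<omega> in M. norm (x \<omega>) \<le> C"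
  proof eventually_elim
    fix \<omega> assume "ereal (norm (x \<omega>)) \<le> esssup M (\<lambda>\<omega>. ereal (norm (x \<omega>)))"
    from order_trans[OF this C] show "norm (x \<omega>) \<le> C" by simp
  qed
  then show "\<exists>C. AE \<omega> in M. norm (x \<omega>) \<le> C" ..
next
  fix C assume [measurable]: "x \<in> borel_measurable M" and C: "AE \<omega> in M. norm (x \<omega>) \<le> C"
  have "esssup M (\<lambda>\<omega>. ereal (norm (x \<omega>))) \<le> ereal C" using C by (intro esssup_I) auto
  then show "x \<in> Lp_space M \<infinity>" by (auto simp: Lp_space_def)
qed

lemma Lp_space_1_iff: "x \<in> Lp_space M 1 \<longleftrightarrow> x \<in> borel_measurable M \<and> integrable M (\<lambda>\<omega>. norm (x \<omega>))"
  using Lp_space_ennreal_iff[of 1 x M] by simp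

lemma Lp_norm_nonneg: "p \<noteq> \<infinity> \<Longrightarrow> 0 \<le> Lp_norm M p x"
  by (simp add: Lp_norm_def)

lemma Lp_space_norm_iff:
  "x \<in> borel_measurable M \<Longrightarrow> (\<lambda>\<omega>. norm (x \<omega>)) \<in> Lp_space M p \<longleftrightarrow> x \<in> Lp_space M p"
  by (simp add: Lp_space_def)

lemma Lp_norm_norm: "Lp_norm M p (\<lambda>\<omega>. norm (x \<omega>)) = Lp_norm M p x"
  by (simp add: Lp_norm_def)

lemma Lp_space_dominated:
  assumes x: "x \<in> Lp_space M p" and y[measurable]: "y \<in> borel_measurable M"
    and le: "AE \<omega> in M. norm (y \<omega>) \<le> norm (x \<omega>)"
  shows "y \<in> Lp_space M p"
proof (cases p)
  case top
  from x obtain C where "AE \<omega> in M. norm (x \<omega>) \<le> C" unfolding top infinity_ennreal_def[symmetric] Lp_space_top_iff by auto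
  with le have "AE \<omega> in M. norm (y \<omega>) \<le> C" by eventually_elim auto
  then show ?thesis unfolding top infinity_ennreal_def[symmetric] Lp_space_top_iff by auto
next
  case (real r)
  note [measurable] = Lp_space_measurable[OF x]
  have "integrable M (\<lambda>\<omega>. norm (x \<omega>) powr r)" using x real by (simp add: Lp_space_ennreal_iff)
  then have "integrable M (\<lambda>\<omega>. norm (y \<omega>) powr r)"
    by (rule Bochner_Integration.integrable_bound) (use le real in \<open>auto elim!: eventually_mono intro: powr_mono2\<close>)
  then show ?thesis using real by (simp add: Lp_space_ennreal_iff)
qed

lemma Lp_space_add:
  fixes x y :: "'a \<Rightarrow> 'b::{real_normed_vector, second_countable_topology}"
  assumes x: "x \<in> Lp_space M p" and y: "y \<in> Lp_space M p"
  shows "(\<lambda>\<omega>. x \<omega> + y \<omega>) \<in> Lp_space M p"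
proof (cases p)
  note [measurable] = Lp_space_measurable[OF x] Lp_space_measurable[OF y]
  case top
  from x y obtain C D where "AE \<omega> in M. norm (x \<omega>) \<le> C" "AE \<omega> in M. norm (y \<omega>) \<le> D" 
    unfolding top infinity_ennreal_def[symmetric] Lp_space_top_iff by auto
  then have "AE \<omega> in M. norm (x \<omega> + y \<omega>) \<le> C + D" by eventually_elim norm
  then show ?thesis unfolding top infinity_ennreal_def[symmetric] Lp_space_top_iff by auto
next
  note [measurable] = Lp_space_measurable[OF x] Lp_space_measurable[OF y]
  case (real r)
  have int: "integrable M (\<lambda>\<omega>. 2 powr r * (norm (x \<omega>) powr r + norm (y \<omega>) powr r))"
    using x y real by (simp add: Lp_space_ennreal_iff)
  have le: "norm (x \<omega> + y \<omega>) powr r \<le> 2 powr r * (norm (x \<omega>) powr r + norm (y \<omega>) powr r)" for \<omega>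
  proof -
    have "norm (x \<omega> + y \<omega>) powr r \<le> (2 * max (norm (x \<omega>)) (norm (y \<omega>))) powr r"
      using real norm_triangle_ineq[of "x \<omega>" "y \<omega>"] by (intro powr_mono2) auto
    also have "\<dots> = 2 powr r * max (norm (x \<omega>)) (norm (y \<omega>)) powr r" by (simp add: powr_mult)
    also have "\<dots> \<le> 2 powr r * (norm (x \<omega>) powr r + norm (y \<omega>) powr r)"
      by (intro mult_left_mono) (auto simp: max_def)
    finally show ?thesis .
  qed
  have "integrable M (\<lambda>\<omega>. norm (x \<omega> + y \<omega>) powr r)"
    by (rule Bochner_Integration.integrable_bound[OF int]) (use le in \<open>auto intro!: AE_I2\<close>)
  then show ?thesis using real by (simp add: Lp_space_ennreal_iff)
qed

lemma Lp_space_scaleR: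
  assumes x: "x \<in> Lp_space M p"
  shows "(\<lambda>\<omega>. c *\<^sub>R x \<omega>) \<in> Lp_space M p"
proof (cases p)
  note [measurable] = Lp_space_measurable[OF x]
  case top
  from x obtain C where "AE \<omega> in M. norm (x \<omega>) \<le> C"
    unfolding top infinity_ennreal_def[symmetric] Lp_space_top_iff by auto
  then have "AE \<omega> in M. norm (c *\<^sub>R x \<omega>) \<le> \<bar>c\<bar> * C" by eventually_elim (simp add: mult_left_mono)
  then show ?thesis unfolding top infinity_ennreal_def[symmetric] Lp_space_top_iff by auto
next
  note [measurable] = Lp_space_measurable[OF x]
  case (real r)
  then show ?thesis using x by (auto simp: Lp_space_ennreal_iff powr_mult)
qed

lemma Lp_space_mult: "x \<in> Lp_space M p \<Longrightarrow> (\<lambda>\<omega>. c * x \<omega> :: real) \<in> Lp_space M p"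
  using Lp_space_scaleR[of x M p c] by simp

lemma Lp_space_diff:
  fixes x y :: "'a \<Rightarrow> 'b::{real_normed_vector, second_countable_topology}"
  assumes "x \<in> Lp_space M p" "y \<in> Lp_space M p"
  shows "(\<lambda>\<omega>. x \<omega> - y \<omega>) \<in> Lp_space M p"
  using Lp_space_add[OF assms(1) Lp_space_scaleR[OF assms(2), of "-1"]] by simp

lemma Lp_space_indicator_scaleR:
  fixes x :: "'a \<Rightarrow> 'b::{real_normed_vector, second_countable_topology}"
  assumes [measurable]: "A \<in> sets M" and x: "x \<in> Lp_space M p"
  shows "(\<lambda>\<omega>. indicator A \<omega> *\<^sub>R x \<omega>) \<in> Lp_space M p"
proof (rule Lp_space_dominated[OF x])
  note [measurable] = Lp_space_measurable[OF x]
  show "(\<lambda>\<omega>. indicator A \<omega> *\<^sub>R x \<omega>) \<in> borel_measurable M" by measurable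
qed (auto simp: indicator_def)

lemma (in finite_measure) Lp_space_const: "(\<lambda>\<omega>. c) \<in> Lp_space M p"
proof (cases p)
  case top
  show ?thesis unfolding top infinity_ennreal_def[symmetric] Lp_space_top_iff by auto
next
  case (real r)
  then show ?thesis by (simp add: Lp_space_ennreal_iff)
qed

lemma (in finite_measure) Lp_space_bounded:
  assumes [measurable]: "x \<in> borel_measurable M" and "AE \<omega> in M. norm (x \<omega>) \<le> C"
  shows "x \<in> Lp_space M p"
  using assms by (intro Lp_space_dominated[OF Lp_space_const[of C]]) auto

lemma (in finite_measure) subspace_Lp_space:
  "subspace (Lp_space M p :: ('a \<Rightarrow> 'b::{real_normed_vector, second_countable_topology}) set)"
  using Lp_space_const[of "0 :: 'b"] Lp_space_add[of _ M p] Lp_space_scaleR[of _ M p]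
  by (auto simp: subspace_def zero_fun_def plus_fun_def scaleR_fun_def)

lemma (in prob_space) Lp_norm_top_bound:
  assumes x: "x \<in> Lp_space M \<infinity>"
  shows "AE \<omega> in M. norm (x \<omega>) \<le> Lp_norm M \<infinity> x" "0 \<le> Lp_norm M \<infinity> x"
proof -
  note [measurable] = Lp_space_measurable[OF x]
  let ?e = "esssup M (\<lambda>\<omega>. ereal (norm (x \<omega>)))"
  have "0 = esssup M (\<lambda>\<omega>. 0 :: ereal)" by (simp add: esssup_const emeasure_space_1)
  also have "\<dots> \<le> ?e" by (intro esssup_mono) auto
  finally have ge: "0 \<le> ?e" .
  moreover have "?e < \<infinity>" using x by (simp add: Lp_space_def)
  ultimately have e: "ereal (Lp_norm M \<infinity> x) = ?e" by (simp add: Lp_norm_def ereal_real)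
  show "AE \<omega> in M. norm (x \<omega>) \<le> Lp_norm M \<infinity> x"
    using esssup_AE[of "\<lambda>\<omega>. ereal (norm (x \<omega>))" M] unfolding e[symmetric] by simp
  show "0 \<le> Lp_norm M \<infinity> x" using ge e[symmetric] by simp
qed

text \<open>
  A form of completeness that involves only the order: the \<open>r\<close>-th root of
  \<open>\<Sum>n. \<bar>U n\<bar> powr r\<close> dominates every \<open>U n\<close>, and the integral of its \<open>r\<close>-th power is at most the sum of a
  geometric series. Where the series diverges, on a null set, \<open>enn2real\<close> supplies the value \<open>0\<close>.
\<close>
lemma Lp_space_dominating_sequence:
  fixes U :: "nat \<Rightarrow> 'a \<Rightarrow> real"
  assumes r: "1 \<le> r" and U: "\<And>n. U n \<in> Lp_space M (ennreal r)"
    and small: "\<And>n. (\<integral>\<omega>. norm (U n \<omega>) powr r \<partial>M) \<le> (1/2) ^ n"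
  obtains W where "W \<in> Lp_space M (ennreal r)" "\<And>n. AE \<omega> in M. U n \<omega> \<le> W \<omega>"
proof -
  note [measurable] = Lp_space_measurable[OF U]
  define S where "S \<omega> = (\<Sum>n. ennreal (norm (U n \<omega>) powr r))" for \<omega>
  have [measurable]: "S \<in> borel_measurable M" unfolding S_def by measurable
  have "(\<integral>\<^sup>+\<omega>. S \<omega> \<partial>M) = (\<Sum>n. \<integral>\<^sup>+\<omega>. ennreal (norm (U n \<omega>) powr r) \<partial>M)"
    unfolding S_def by (rule nn_integral_suminf) measurable
  also have "\<dots> = (\<Sum>n. ennreal (\<integral>\<omega>. norm (U n \<omega>) powr r \<partial>M))"
    using U r by (intro suminf_cong nn_integral_eq_integral) (auto simp: Lp_space_ennreal_iff)
  also have "\<dots> \<le> (\<Sum>n. ennreal ((1/2) ^ n))"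
    using small by (intro suminf_le ennreal_leI) auto
  also have "\<dots> = ennreal (\<Sum>n. (1/2) ^ n)"
    by (intro suminf_ennreal2) auto
  finally have fin: "(\<integral>\<^sup>+\<omega>. S \<omega> \<partial>M) < \<infinity>"
    unfolding infinity_ennreal_def by (rule order_le_less_trans) (rule ennreal_less_top)
  then have AEfin: "AE \<omega> in M. S \<omega> \<noteq> \<infinity>" by (intro nn_integral_PInf_AE) auto
  define W where "W \<omega> = enn2real (S \<omega>) powr (1 / r)" for \<omega>
  have [measurable]: "W \<in> borel_measurable M" unfolding W_def by measurable
  have "norm (W \<omega>) powr r = enn2real (S \<omega>)" for \<omega>
    using r by (simp add: W_def powr_powr)
  moreover have "integrable M (\<lambda>\<omega>. enn2real (S \<omega>))"
  proof (rule integrableI_bounded)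
    have "(\<integral>\<^sup>+\<omega>. ennreal (norm (enn2real (S \<omega>))) \<partial>M) \<le> (\<integral>\<^sup>+\<omega>. S \<omega> \<partial>M)"
      using AEfin by (intro nn_integral_mono_AE) (auto elim!: eventually_mono simp: less_top)
    then show "(\<integral>\<^sup>+\<omega>. ennreal (norm (enn2real (S \<omega>))) \<partial>M) < \<infinity>" using fin by order
  qed measurable
  ultimately have "W \<in> Lp_space M (ennreal r)" using r by (simp add: Lp_space_ennreal_iff)
  moreover have "AE \<omega> in M. U n \<omega> \<le> W \<omega>" for n
    using AEfin
  proof eventually_elim
    fix \<omega> assume "S \<omega> \<noteq> \<infinity>"
    have "(\<Sum>i\<in>{n}. ennreal (norm (U i \<omega>) powr r)) \<le> S \<omega>"
      unfolding S_def by (rule sum_le_suminf) auto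
    then have "ennreal (norm (U n \<omega>) powr r) \<le> S \<omega>" by simp
    then have "norm (U n \<omega>) powr r \<le> enn2real (S \<omega>)"
      using \<open>S \<omega> \<noteq> \<infinity>\<close> by (metis enn2real_ennreal enn2real_mono infinity_ennreal_def less_top powr_ge_zero)
    then have "(norm (U n \<omega>) powr r) powr (1 / r) \<le> W \<omega>"
      unfolding W_def using r by (intro powr_mono2) auto
    then show "U n \<omega> \<le> W \<omega>" using r by (simp add: powr_powr)
  qed
  ultimately show ?thesis using that by blast
qed

text \<open>
  Monotonicity forces boundedness. Otherwise there would be nonnegative \<open>U n\<close> of norm \<open>1 / 2 ^ n\<close> with
  \<open>\<Lambda> (U n) > 2 ^ n\<close>; a common upper bound \<open>W\<close> in the space would satisfy \<open>\<Lambda> W > 2 ^ n\<close> for all \<open>n\<close>.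
\<close>
lemma monotone_homogeneous_Lp_bounded:
  fixes \<Lambda> :: "('a \<Rightarrow> real) \<Rightarrow> real"
  assumes p: "1 \<le> p" "p < \<infinity>"
    and mono: "\<And>V W. V \<in> Lp_space M p \<Longrightarrow> W \<in> Lp_space M p \<Longrightarrow> AE \<omega> in M. V \<omega> \<le> W \<omega> \<Longrightarrow> \<Lambda> V \<le> \<Lambda> W"
    and hom: "\<And>c V. V \<in> Lp_space M p \<Longrightarrow> \<Lambda> (\<lambda>\<omega>. c * V \<omega>) = c * \<Lambda> V"
  obtains C where "0 \<le> C" "\<And>V. V \<in> Lp_space M p \<Longrightarrow> \<bar>\<Lambda> V\<bar> \<le> C * Lp_norm M p V"
proof -
  obtain r where pr: "p = ennreal r" and r: "1 \<le> r" using p by (cases p) auto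
  have abs: "(\<lambda>\<omega>. \<bar>V \<omega>\<bar>) \<in> Lp_space M p" if "V \<in> Lp_space M p" for V :: "'a \<Rightarrow> real"
    using Lp_space_norm_iff[of V M p] that by (simp add: Lp_space_measurable)
  have \<Lambda>abs: "\<bar>\<Lambda> V\<bar> \<le> \<Lambda> (\<lambda>\<omega>. \<bar>V \<omega>\<bar>)" if V: "V \<in> Lp_space M p" for V
    using mono[OF V abs[OF V]] mono[OF Lp_space_mult[OF V, of "-1"] abs[OF V]] hom[OF V, of "-1"] by auto
  have "\<exists>C\<ge>0. \<forall>V\<in>Lp_space M p. \<bar>\<Lambda> V\<bar> \<le> C * Lp_norm M p V"
  proof (rule ccontr)
    assume contr: "\<not> ?thesis"
    \<comment> \<open>One factor \<open>2 ^ n\<close> of \<open>4 ^ n\<close> makes the norms summable, the other makes the values unbounded.\<close>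
    have "\<exists>V\<in>Lp_space M p. \<bar>\<Lambda> V\<bar> > 4 ^ n * Lp_norm M p V" for n :: nat
    proof (rule ccontr)
      assume "\<not> ?thesis"
      then have "\<forall>V\<in>Lp_space M p. \<bar>\<Lambda> V\<bar> \<le> 4 ^ n * Lp_norm M p V" by auto
      moreover have "0 \<le> (4 :: real) ^ n" by simp
      ultimately show False using contr by blast
    qed
    then obtain V where V: "\<And>n. V n \<in> Lp_space M p" "\<And>n. \<bar>\<Lambda> (V n)\<bar> > 4 ^ n * Lp_norm M p (V n)"
      by metis
    define N where "N n = Lp_norm M p (V n)" for n
    have N0: "0 \<le> N n" for n using p by (simp add: N_def Lp_norm_nonneg)
    have Nr: "N n powr r = (\<integral>\<omega>. norm (V n \<omega>) powr r \<partial>M)" for n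
      using r by (simp add: N_def pr Lp_norm_ennreal powr_powr)
    have N: "0 < N n" for n
    proof (rule ccontr)
      assume "\<not> 0 < N n"
      then have "(\<integral>\<omega>. norm (V n \<omega>) powr r \<partial>M) = 0" using Nr[of n] N0[of n] by simp
      then have "AE \<omega> in M. norm (V n \<omega>) powr r = 0"
        using V(1)[of n] r by (subst (asm) integral_nonneg_eq_0_iff_AE) (auto simp: pr Lp_space_ennreal_iff)
      then have "AE \<omega> in M. \<bar>V n \<omega>\<bar> \<le> 0 * V n \<omega>" by eventually_elim auto
      then have "\<Lambda> (\<lambda>\<omega>. \<bar>V n \<omega>\<bar>) \<le> 0"
        using mono[OF abs[OF V(1)[of n]] Lp_space_mult[OF V(1)[of n], of 0]] hom[OF V(1)[of n], of 0] by simp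
      then show False using \<Lambda>abs[OF V(1)[of n]] V(2)[of n] N0[of n] by (simp add: N_def) (smt (verit) mult_nonneg_nonneg zero_le_power)
    qed
    define U where "U n \<omega> = (1 / (2 ^ n * N n)) * \<bar>V n \<omega>\<bar>" for n \<omega>
    have U: "U n \<in> Lp_space M p" for n
      unfolding U_def by (intro Lp_space_mult abs V)
    have "(\<integral>\<omega>. norm (U n \<omega>) powr r \<partial>M) \<le> (1/2) ^ n" for n
    proof -
      have "norm (U n \<omega>) powr r = (1 / 2 ^ n) powr r / N n powr r * norm (V n \<omega>) powr r" for \<omega>
        using N[of n] by (simp add: U_def abs_mult powr_mult powr_divide)
      then have "(\<integral>\<omega>. norm (U n \<omega>) powr r \<partial>M) = (1 / 2 ^ n) powr r / N n powr r * N n powr r"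
        by (simp only: Nr integral_mult_right_zero)
      also have "\<dots> = (1 / 2 ^ n) powr r" using N[of n] by simp
      also have "\<dots> \<le> (1 / 2 ^ n) powr 1" using r by (intro powr_mono') auto
      finally show ?thesis by (simp add: power_one_over)
    qed
    then obtain W where W: "W \<in> Lp_space M p" "\<And>n. AE \<omega> in M. U n \<omega> \<le> W \<omega>"
      using Lp_space_dominating_sequence[OF r, of U M] U by (auto simp: pr)
    have "2 ^ n < \<Lambda> W" for n
    proof -
      have "(2::real) ^ n * 2 ^ n = 4 ^ n" by (simp flip: power_mult_distrib)
      then have "2 ^ n * N n * 2 ^ n = 4 ^ n * N n" by (simp add: mult.commute mult.left_commute)
      also have "\<dots> < \<Lambda> (\<lambda>\<omega>. \<bar>V n \<omega>\<bar>)" using V(2)[of n] \<Lambda>abs[OF V(1)[of n]] by (simp add: N_def)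
      finally have "2 ^ n < \<Lambda> (\<lambda>\<omega>. \<bar>V n \<omega>\<bar>) / (2 ^ n * N n)" using N[of n] by (simp add: field_simps)
      also have "\<dots> = \<Lambda> (U n)" using hom[OF abs[OF V(1)[of n]], of "1 / (2 ^ n * N n)"] by (simp add: U_def[abs_def])
      also have "\<dots> \<le> \<Lambda> W" by (intro mono U W)
      finally show ?thesis .
    qed
    moreover obtain n where "\<Lambda> W < 2 ^ n" using real_arch_pow[of 2 "\<Lambda> W"] by auto
    ultimately show False by (meson less_asym)
  qed
  then show ?thesis using that by blast
qed

section \<open>Densities of finitely additive set functions\<close>

text \<open>
  The Radon--Nikodym theorem for a finitely additive function on events. Continuity at the empty set
  is equivalent to countable additivity, and it is the condition that is easy to check when
  \<open>\<mu> A\<close> is the value of a functional at a function cut off outside \<open>A\<close>.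
\<close>
lemma (in prob_space) finitely_additive_density:
  fixes \<mu> :: "'a set \<Rightarrow> real"
  assumes nonneg: "\<And>A. A \<in> events \<Longrightarrow> 0 \<le> \<mu> A"
    and add: "\<And>A B. A \<in> events \<Longrightarrow> B \<in> events \<Longrightarrow> A \<inter> B = {} \<Longrightarrow> \<mu> (A \<union> B) = \<mu> A + \<mu> B"
    and null: "\<And>A. A \<in> null_sets M \<Longrightarrow> \<mu> A = 0"
    and cont: "\<And>A. range A \<subseteq> events \<Longrightarrow> decseq A \<Longrightarrow> (\<Inter>i. A i) = {} \<Longrightarrow> (\<lambda>i. \<mu> (A i)) \<longlonglongrightarrow> 0"
  obtains d where "d \<in> borel_measurable M" "\<And>\<omega>. 0 \<le> d \<omega>" "integrable M d"
    "\<And>A. A \<in> events \<Longrightarrow> \<mu> A = (\<integral>\<omega>. indicator A \<omega> * d \<omega> \<partial>M)"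
proof -
  define N where "N = measure_of (space M) events (\<lambda>A. ennreal (\<mu> A))"
  have sN: "sets N = events" "space N = space M" by (simp_all add: N_def)
  have pos: "positive events (\<lambda>A. ennreal (\<mu> A))"
    using null[of "{}"] by (simp add: positive_def)
  have ca: "countably_additive events (\<lambda>A. ennreal (\<mu> A))"
  proof (rule sets.empty_continuous_imp_countably_additive[OF pos])
    show "additive events (\<lambda>A. ennreal (\<mu> A))"
      using add nonneg by (auto simp: additive_def)
    show "(\<lambda>i. ennreal (\<mu> (A i))) \<longlonglongrightarrow> 0"
      if "range A \<subseteq> events" "decseq A" "(\<Inter>i. A i) = {}" for A
      using tendsto_ennrealI[OF cont[OF that]] by simp
  qed auto
  have em: "emeasure N A = ennreal (\<mu> A)" if "A \<in> events" for A
    unfolding N_def using pos ca that by (intro emeasure_measure_of_sigma sets.sigma_algebra_axioms)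
  have "absolutely_continuous M N"
    using null by (auto simp: absolutely_continuous_def null_sets_def sN em)
  then obtain f where f[measurable]: "f \<in> borel_measurable M" and fN: "density M f = N"
    using Radon_Nikodym sN by blast
  have emf: "(\<integral>\<^sup>+\<omega>. f \<omega> * indicator A \<omega> \<partial>M) = ennreal (\<mu> A)" if "A \<in> events" for A
    using em[OF that] that by (simp add: emeasure_density flip: fN)
  have int_f: "(\<integral>\<^sup>+\<omega>. f \<omega> \<partial>M) = ennreal (\<mu> (space M))"
  proof -
    have "(\<integral>\<^sup>+\<omega>. f \<omega> \<partial>M) = (\<integral>\<^sup>+\<omega>. f \<omega> * indicator (space M) \<omega> \<partial>M)"
      by (intro nn_integral_cong) auto
    then show ?thesis using emf[OF sets.top] by simp
  qed
  then have fin: "AE \<omega> in M. f \<omega> \<noteq> \<infinity>" by (intro nn_integral_PInf_AE) auto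
  define d where "d \<omega> = enn2real (f \<omega>)" for \<omega>
  have [measurable]: "d \<in> borel_measurable M" unfolding d_def by measurable
  have df: "AE \<omega> in M. ennreal (d \<omega>) = f \<omega>"
    using fin by eventually_elim (simp add: d_def less_top)
  have d0: "0 \<le> d \<omega>" for \<omega> by (simp add: d_def)
  have "integrable M d"
  proof (rule integrableI_bounded)
    have "(\<integral>\<^sup>+\<omega>. ennreal (norm (d \<omega>)) \<partial>M) = (\<integral>\<^sup>+\<omega>. f \<omega> \<partial>M)"
      using df d0 by (intro nn_integral_cong_AE) auto
    then show "(\<integral>\<^sup>+\<omega>. ennreal (norm (d \<omega>)) \<partial>M) < \<infinity>" using int_f by simp
  qed measurable
  moreover have "\<mu> A = (\<integral>\<omega>. indicator A \<omega> * d \<omega> \<partial>M)" if A[measurable]: "A \<in> events" for A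
  proof -
    have "(\<integral>\<^sup>+\<omega>. ennreal (indicator A \<omega> * d \<omega>) \<partial>M) = (\<integral>\<^sup>+\<omega>. f \<omega> * indicator A \<omega> \<partial>M)"
      using df by (intro nn_integral_cong_AE) (auto simp: indicator_def)
    then have "(\<integral>\<omega>. indicator A \<omega> * d \<omega> \<partial>M) = enn2real (ennreal (\<mu> A))"
      using d0 emf[OF A] by (subst integral_eq_nn_integral) (auto simp: indicator_def)
    then show ?thesis using nonneg[OF A] by simp
  qed
  ultimately show ?thesis using that d0 by (metis \<open>d \<in> borel_measurable M\<close>)
qed

section \<open>Duality of Lebesgue spaces\<close>

lemma integrable_product_conjugate:
  fixes a b :: "'a \<Rightarrow> real"
  assumes p: "1 \<le> p" "1 / p + 1 / q = 1" and a: "a \<in> Lp_space M p" and b: "b \<in> Lp_space M q"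
  shows "integrable M (\<lambda>\<omega>. a \<omega> * b \<omega>)"
proof -
  note [measurable] = Lp_space_measurable[OF a] Lp_space_measurable[OF b]
  have bdd: "integrable M (\<lambda>\<omega>. u \<omega> * v \<omega>)"
    if u: "u \<in> Lp_space M 1" and v: "v \<in> Lp_space M \<infinity>" for u v :: "'a \<Rightarrow> real"
  proof -
    note [measurable] = Lp_space_measurable[OF u] Lp_space_measurable[OF v]
    obtain C where C: "AE \<omega> in M. norm (v \<omega>) \<le> C" using v unfolding Lp_space_top_iff by auto
    have "integrable M (\<lambda>\<omega>. norm (u \<omega>) * C)" using u by (simp add: Lp_space_1_iff)
    then show ?thesis
    proof (rule Bochner_Integration.integrable_bound)
      show "AE \<omega> in M. norm (u \<omega> * v \<omega>) \<le> norm (norm (u \<omega>) * C)"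
        using C by eventually_elim (auto simp: abs_mult intro!: mult_left_mono)
    qed measurable
  qed
  show ?thesis
    using p
  proof (cases rule: conjugate_exponent_cases)
    case one
    then show ?thesis using bdd a b by auto
  next
    case top
    then show ?thesis using bdd[of b a] a b by (auto simp: mult.commute)
  next
    case (real r s)
    have "integrable M (\<lambda>\<omega>. norm (a \<omega>) powr r / r + norm (b \<omega>) powr s / s)"
      using a b real by (simp add: Lp_space_ennreal_iff)
    then show ?thesis
    proof (rule Bochner_Integration.integrable_bound)
      have "norm (a \<omega> * b \<omega>) \<le> norm (norm (a \<omega>) powr r / r + norm (b \<omega>) powr s / s)" for \<omega>
        using Youngs_inequality[OF real(3,4,5), of "norm (a \<omega>)" "norm (b \<omega>)"] real(3,4)
        by (auto simp: abs_mult)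
      then show "AE \<omega> in M. norm (a \<omega> * b \<omega>) \<le> norm (norm (a \<omega>) powr r / r + norm (b \<omega>) powr s / s)"
        by simp
    qed measurable
  qed
qed

text \<open>
  Integrability of all the products suffices for boundedness, since the functional is positive; this
  replaces the inequality of Hoelder for norms.
\<close>
lemma integral_against_nonneg_bounded:
  fixes \<gamma> :: "'a \<Rightarrow> real"
  assumes p: "1 \<le> p" "p < \<infinity>" and \<gamma>: "\<And>\<omega>. 0 \<le> \<gamma> \<omega>"
    and int: "\<And>\<beta>. \<beta> \<in> Lp_space M p \<Longrightarrow> integrable M (\<lambda>\<omega>. \<gamma> \<omega> * \<beta> \<omega>)"
  obtains C where "0 \<le> C" "\<And>\<beta>. \<beta> \<in> Lp_space M p \<Longrightarrow> \<bar>\<integral>\<omega>. \<gamma> \<omega> * \<beta> \<omega> \<partial>M\<bar> \<le> C * Lp_norm M p \<beta>"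
proof (rule monotone_homogeneous_Lp_bounded[OF p, of M "\<lambda>\<beta>. \<integral>\<omega>. \<gamma> \<omega> * \<beta> \<omega> \<partial>M"])
  fix V W :: "'a \<Rightarrow> real" assume V: "V \<in> Lp_space M p" and W: "W \<in> Lp_space M p" and le: "AE \<omega> in M. V \<omega> \<le> W \<omega>"
  show "(\<integral>\<omega>. \<gamma> \<omega> * V \<omega> \<partial>M) \<le> (\<integral>\<omega>. \<gamma> \<omega> * W \<omega> \<partial>M)"
    using le by (intro integral_mono_AE int V W) (auto intro: mult_left_mono \<gamma>)
next
  fix c and V :: "'a \<Rightarrow> real"
  have "(\<integral>\<omega>. \<gamma> \<omega> * (c * V \<omega>) \<partial>M) = (\<integral>\<omega>. c * (\<gamma> \<omega> * V \<omega>) \<partial>M)"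
    by (simp add: mult.left_commute)
  then show "(\<integral>\<omega>. \<gamma> \<omega> * (c * V \<omega>) \<partial>M) = c * (\<integral>\<omega>. \<gamma> \<omega> * V \<omega> \<partial>M)" by simp
qed (use that in blast)

text \<open>
  The converse of the inequality of Hoelder. For \<open>p = 1\<close> the bound is tested on the indicator of
  \<open>{\<gamma> > C}\<close>; for \<open>1 < p < \<infinity>\<close> it is tested on \<open>g powr (s - 1)\<close>, where \<open>g\<close> is a truncation of \<open>\<gamma>\<close>, which
  bounds the integral of \<open>g powr s\<close> independently of the truncation.
\<close>
lemma (in prob_space) Lp_space_conjugateI:
  fixes \<gamma> :: "'a \<Rightarrow> real"
  assumes p: "1 \<le> p" "1 / p + 1 / q = 1"
    and [measurable]: "\<gamma> \<in> borel_measurable M" and \<gamma>: "\<And>\<omega>. 0 \<le> \<gamma> \<omega>"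
    and int: "\<And>\<beta>. \<beta> \<in> Lp_space M p \<Longrightarrow> integrable M (\<lambda>\<omega>. \<gamma> \<omega> * \<beta> \<omega>)"
  shows "\<gamma> \<in> Lp_space M q"
  using p
proof (cases rule: conjugate_exponent_cases)
  case top
  then show ?thesis using int[OF Lp_space_const, of 1] \<gamma> by (simp add: Lp_space_1_iff)
next
  case one
  obtain C where C: "0 \<le> C" "\<And>\<beta>. \<beta> \<in> Lp_space M p \<Longrightarrow> \<bar>\<integral>\<omega>. \<gamma> \<omega> * \<beta> \<omega> \<partial>M\<bar> \<le> C * Lp_norm M p \<beta>"
    using integral_against_nonneg_bounded[OF p(1) _ \<gamma> int] one(1) by auto
  define A where "A = {\<omega>\<in>space M. C < \<gamma> \<omega>}"
  have [measurable]: "A \<in> events" unfolding A_def by measurable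
  have iA: "(indicator A :: 'a \<Rightarrow> real) \<in> Lp_space M p" by (rule Lp_space_bounded[of _ 1]) (auto simp: indicator_def)
  have "Lp_norm M p (indicator A :: 'a \<Rightarrow> real) = (\<integral>\<omega>. indicator A \<omega> \<partial>M)"
  proof -
    have "norm (indicator A \<omega> :: real) powr 1 = indicator A \<omega>" for \<omega>
      by (simp add: indicator_def)
    then show ?thesis using Lp_norm_ennreal[of 1 M "indicator A :: 'a \<Rightarrow> real"] one(1) by simp
  qed
  then have le: "(\<integral>\<omega>. \<gamma> \<omega> * indicator A \<omega> \<partial>M) \<le> C * (\<integral>\<omega>. indicator A \<omega> \<partial>M)"
    using order_trans[OF abs_ge_self C(2)[OF iA]] by (simp only:)
  have iC: "integrable M (\<lambda>\<omega>. C * indicator A \<omega>)"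
    by (intro integrable_mult_right integrable_const_bound[of _ 1]) (auto simp: indicator_def)
  have i: "integrable M (\<lambda>\<omega>. (\<gamma> \<omega> - C) * indicator A \<omega>)"
    using Bochner_Integration.integrable_diff[OF int[OF iA] iC] by (simp add: left_diff_distrib)
  have "(\<integral>\<omega>. (\<gamma> \<omega> - C) * indicator A \<omega> \<partial>M) \<le> 0"
    using le Bochner_Integration.integral_diff[OF int[OF iA] iC] by (simp add: left_diff_distrib)
  moreover have nn: "0 \<le> (\<gamma> \<omega> - C) * indicator A \<omega>" for \<omega>
    by (auto simp: A_def indicator_def)
  ultimately have "(\<integral>\<omega>. (\<gamma> \<omega> - C) * indicator A \<omega> \<partial>M) = 0"
    by (intro antisym Bochner_Integration.integral_nonneg) auto
  then have "AE \<omega> in M. (\<gamma> \<omega> - C) * indicator A \<omega> = 0"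
    using integral_nonneg_eq_0_iff_AE[OF i] nn by simp
  then have "AE \<omega> in M. norm (\<gamma> \<omega>) \<le> C"
    using AE_space by eventually_elim (use \<gamma> in \<open>auto simp: A_def indicator_def split: if_splits\<close>)
  then show ?thesis unfolding one(2) Lp_space_top_iff by auto
next
  case (real r s)
  obtain C where C: "0 \<le> C" "\<And>\<beta>. \<beta> \<in> Lp_space M p \<Longrightarrow> \<bar>\<integral>\<omega>. \<gamma> \<omega> * \<beta> \<omega> \<partial>M\<bar> \<le> C * Lp_norm M p \<beta>"
    using integral_against_nonneg_bounded[OF p(1) _ \<gamma> int] real by auto
  have rs: "(s - 1) * r = s" "1 - 1 / r = 1 / s"
    using real by (auto simp: field_simps)
  define g where "g n \<omega> = min (\<gamma> \<omega>) (real n)" for n \<omega>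
  have [measurable]: "g n \<in> borel_measurable M" for n unfolding g_def by measurable
  have g: "0 \<le> g n \<omega>" "g n \<omega> \<le> \<gamma> \<omega>" "g n \<omega> \<le> n" for n \<omega> using \<gamma> by (auto simp: g_def)
  define I where "I n = (\<integral>\<omega>. g n \<omega> powr s \<partial>M)" for n
  have gi: "integrable M (\<lambda>\<omega>. g n \<omega> powr s)" for n
    using g real by (intro integrable_const_bound[of _ "real n powr s"]) (auto intro!: powr_mono2)
  have IC: "I n \<le> C powr s" for n
  proof -
    let ?\<beta> = "\<lambda>\<omega>. g n \<omega> powr (s - 1)"
    have \<beta>: "?\<beta> \<in> Lp_space M p"
      using g real by (intro Lp_space_bounded[of _ "real n powr (s - 1)"]) (auto intro!: powr_mono2)
    have "I n = (\<integral>\<omega>. g n \<omega> * ?\<beta> \<omega> \<partial>M)"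
      unfolding I_def using g real by (intro Bochner_Integration.integral_cong) (auto simp: powr_mult_base)
    also have "\<dots> \<le> (\<integral>\<omega>. \<gamma> \<omega> * ?\<beta> \<omega> \<partial>M)"
      using g \<gamma> by (intro integral_mono' int \<beta> mult_right_mono) auto
    also have "\<dots> \<le> C * Lp_norm M p ?\<beta>" using C(2)[OF \<beta>] by linarith
    also have "Lp_norm M p ?\<beta> = I n powr (1 / r)"
      using real g by (simp add: Lp_norm_ennreal powr_powr rs I_def)
    finally have le: "I n \<le> C * I n powr (1 / r)" .
    have I0: "0 \<le> I n" unfolding I_def by (intro Bochner_Integration.integral_nonneg) auto
    show ?thesis
    proof (cases "I n = 0")
      case False
      then have "I n powr (1 / s) = I n / I n powr (1 / r)"
        using I0 by (simp add: powr_diff flip: rs(2))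
      also have "\<dots> \<le> C" using le False I0 by (simp add: field_simps)
      finally have "(I n powr (1 / s)) powr s \<le> C powr s" using real by (intro powr_mono2) auto
      then show ?thesis using real I0 by (simp add: powr_powr)
    qed (use C in auto)
  qed
  have "incseq I"
  proof (rule incseq_SucI)
    fix n show "I n \<le> I (Suc n)" unfolding I_def using g real
      by (intro Bochner_Integration.integral_mono gi powr_mono2) (auto simp: g_def)
  qed
  then obtain L where L: "I \<longlonglongrightarrow> L"
    by (rule incseq_convergent[of I "C powr s"]) (use IC in auto)
  have "integrable M (\<lambda>\<omega>. \<gamma> \<omega> powr s)"
  proof (rule integral_monotone_convergence_nonneg(1)[where f = "\<lambda>n \<omega>. g n \<omega> powr s" and x = L])
    show "AE \<omega> in M. mono (\<lambda>n. g n \<omega> powr s)"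
      using g real by (auto intro!: AE_I2 monoI powr_mono2 simp: g_def)
    show "AE \<omega> in M. (\<lambda>n. g n \<omega> powr s) \<longlonglongrightarrow> \<gamma> \<omega> powr s"
    proof (rule AE_I2)
      fix \<omega>
      have "eventually (\<lambda>n. g n \<omega> powr s = \<gamma> \<omega> powr s) sequentially"
        using eventually_ge_at_top[of "nat \<lceil>\<gamma> \<omega>\<rceil>"] by eventually_elim (simp add: g_def nat_le_iff ceiling_le_iff)
      then show "(\<lambda>n. g n \<omega> powr s) \<longlonglongrightarrow> \<gamma> \<omega> powr s" by (rule tendsto_eventually)
    qed
  qed (use gi L in \<open>auto simp: I_def[abs_def]\<close>)
  then show ?thesis using real \<gamma> by (simp add: Lp_space_ennreal_iff)
qed

text \<open>
  The Riesz representation theorem, for positive functionals. Such a functional is bounded, so by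
  dominated convergence for the norm (here \<open>p < \<infinity>\<close> is essential) it is continuous along dominated
  sequences. Hence \<open>A \<mapsto> \<Lambda> (indicator A)\<close> has a density, and the representation passes from indicators
  to monotone limits.
\<close>
lemma (in prob_space) positive_functional_representation:
  fixes \<Lambda> :: "('a \<Rightarrow> real) \<Rightarrow> real"
  assumes p: "1 \<le> p" "p < \<infinity>" "1 / p + 1 / q = 1" and lin: "linear \<Lambda>"
    and mono: "\<And>V W. V \<in> Lp_space M p \<Longrightarrow> W \<in> Lp_space M p \<Longrightarrow> AE \<omega> in M. V \<omega> \<le> W \<omega> \<Longrightarrow> \<Lambda> V \<le> \<Lambda> W"
  obtains \<zeta> where "\<zeta> \<in> Lp_space M q" "\<And>\<omega>. 0 \<le> \<zeta> \<omega>"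
    "\<And>V. V \<in> Lp_space M p \<Longrightarrow> \<Lambda> V = (\<integral>\<omega>. \<zeta> \<omega> * V \<omega> \<partial>M)"
proof -
  obtain r where pr: "p = ennreal r" and r: "1 \<le> r" using p by (cases p) auto
  interpret \<Lambda>: linear \<Lambda> by (rule lin)
  have add: "\<Lambda> (\<lambda>\<omega>. V \<omega> + W \<omega>) = \<Lambda> V + \<Lambda> W" for V W
    using \<Lambda>.add[of V W] by (simp add: plus_fun_def)
  have diff: "\<Lambda> (\<lambda>\<omega>. V \<omega> - W \<omega>) = \<Lambda> V - \<Lambda> W" for V W
    using add[of "\<lambda>\<omega>. V \<omega> - W \<omega>" W] by simp
  have hom: "\<Lambda> (\<lambda>\<omega>. c * V \<omega>) = c * \<Lambda> V" for c V
    using \<Lambda>.scale[of c V] by (simp add: scaleR_fun_def)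
  have zero: "\<Lambda> (\<lambda>\<omega>. 0) = 0" using hom[of 0 "\<lambda>\<omega>. 0"] by simp
  obtain C where C: "0 \<le> C" "\<And>V. V \<in> Lp_space M p \<Longrightarrow> \<bar>\<Lambda> V\<bar> \<le> C * Lp_norm M p V"
    using monotone_homogeneous_Lp_bounded[OF p(1,2), of M \<Lambda>] mono hom by blast
  have conv: "(\<lambda>i. \<Lambda> (D i)) \<longlonglongrightarrow> 0"
    if D: "\<And>i. D i \<in> Lp_space M p" and G: "G \<in> Lp_space M p"
      and le: "\<And>i \<omega>. \<omega> \<in> space M \<Longrightarrow> \<bar>D i \<omega>\<bar> \<le> \<bar>G \<omega>\<bar>"
      and lim: "\<And>\<omega>. \<omega> \<in> space M \<Longrightarrow> (\<lambda>i. D i \<omega>) \<longlonglongrightarrow> 0" for D :: "nat \<Rightarrow> 'a \<Rightarrow> real" and G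
  proof -
    note [measurable] = Lp_space_measurable[OF D] Lp_space_measurable[OF G]
    have "(\<lambda>i. \<integral>\<omega>. norm (D i \<omega>) powr r \<partial>M) \<longlonglongrightarrow> (\<integral>\<omega>. 0 \<partial>M)"
    proof (rule integral_dominated_convergence[where w = "\<lambda>\<omega>. norm (G \<omega>) powr r"])
      show "integrable M (\<lambda>\<omega>. norm (G \<omega>) powr r)" using G r by (simp add: pr Lp_space_ennreal_iff)
      show "AE \<omega> in M. (\<lambda>i. norm (D i \<omega>) powr r) \<longlonglongrightarrow> 0"
        using lim r by (intro AE_I2 tendsto_zero_powrI[where b = r]) (auto intro: tendsto_rabs_zero)
      show "AE \<omega> in M. norm (norm (D i \<omega>) powr r) \<le> norm (G \<omega>) powr r" for i
        using le r by (intro AE_I2) (auto intro!: powr_mono2)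
    qed measurable
    then have "(\<lambda>i. Lp_norm M p (D i)) \<longlonglongrightarrow> 0"
      using r unfolding pr by (simp add: Lp_norm_ennreal) (rule tendsto_zero_powrI[where b = "1 / r"], auto)
    then have "(\<lambda>i. C * Lp_norm M p (D i)) \<longlonglongrightarrow> 0" by (rule tendsto_mult_right_zero)
    then show ?thesis by (rule Lim_null_comparison[rotated]) (use C(2)[OF D] in auto)
  qed
  have ind: "(indicator A :: 'a \<Rightarrow> real) \<in> Lp_space M p" if "A \<in> events" for A
    using that by (intro Lp_space_bounded[of _ 1]) (auto simp: indicator_def)
  have cnst: "(\<lambda>\<omega>. c :: real) \<in> Lp_space M p" for c by (rule Lp_space_const)
  obtain d where [measurable]: "d \<in> borel_measurable M" and d0: "\<And>\<omega>. 0 \<le> d \<omega>" and di: "integrable M d"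
    and d: "\<And>A. A \<in> events \<Longrightarrow> \<Lambda> (indicator A) = (\<integral>\<omega>. indicator A \<omega> * d \<omega> \<partial>M)"
  proof (rule finitely_additive_density[of "\<lambda>A. \<Lambda> (indicator A)"])
    fix A assume "A \<in> events"
    then show "0 \<le> \<Lambda> (indicator A)"
      using mono[OF cnst[of 0] ind[of A]] by (simp add: zero)
  next
    fix A B :: "'a set" assume "A \<inter> B = {}"
    then have "indicator (A \<union> B) = (\<lambda>\<omega>. indicator A \<omega> + indicator B \<omega> :: real)"
      by (auto simp: indicator_def fun_eq_iff)
    then show "\<Lambda> (indicator (A \<union> B)) = \<Lambda> (indicator A) + \<Lambda> (indicator B)" by (simp add: add)
  next
    fix A assume A: "A \<in> null_sets M"
    then have "AE \<omega> in M. indicator A \<omega> = (0 :: real)"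
      by (auto simp: indicator_def dest: AE_not_in elim: eventually_mono)
    then have "\<Lambda> (indicator A) \<le> \<Lambda> (\<lambda>\<omega>. 0)" "\<Lambda> (\<lambda>\<omega>. 0) \<le> \<Lambda> (indicator A)"
      using A by (auto intro!: mono ind cnst elim: eventually_mono)
    then show "\<Lambda> (indicator A) = 0" by (simp add: zero)
  next
    fix A :: "nat \<Rightarrow> 'a set" assume A: "range A \<subseteq> events" "decseq A" "(\<Inter>i. A i) = {}"
    show "(\<lambda>i. \<Lambda> (indicator (A i))) \<longlonglongrightarrow> 0"
    proof (rule conv[OF ind cnst[of 1]])
      fix \<omega>
      obtain k where "\<omega> \<notin> A k" using A(3) by auto
      then have "\<forall>i\<ge>k. indicator (A i) \<omega> = (0 :: real)"
        using A(2) by (auto simp: decseq_def indicator_def)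
      then show "(\<lambda>i. indicator (A i) \<omega> :: real) \<longlonglongrightarrow> 0"
        by (intro tendsto_eventually) (auto simp: eventually_sequentially)
    qed (use A in \<open>auto simp: indicator_def\<close>)
  qed blast
  have nonneg: "integrable M (\<lambda>\<omega>. d \<omega> * u \<omega>) \<and> \<Lambda> u = (\<integral>\<omega>. d \<omega> * u \<omega> \<partial>M)"
    if u: "u \<in> Lp_space M p" "\<And>\<omega>. 0 \<le> u \<omega>" for u
    using Lp_space_measurable[OF u(1)] u(2) u(1)
  proof (induction rule: borel_measurable_induct_real)
    case (set A)
    then show ?case using d[of A] integrable_real_mult_indicator[OF set(1) di] by (simp add: mult.commute)
  next
    case (mult u c)
    show ?case
    proof (cases "c = 0")
      case False
      have "u \<in> Lp_space M p" using Lp_space_mult[OF mult.prems, of "1 / c"] False by simp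
      then show ?thesis using mult.IH by (simp add: hom mult.left_commute)
    qed (simp add: zero)
  next
    case (add u v)
    have "u \<in> Lp_space M p" "v \<in> Lp_space M p"
      using add.hyps by (auto intro!: Lp_space_dominated[OF add.prems])
    then show ?case using add.IH by (simp add: \<open>\<And>V W. \<Lambda> (\<lambda>\<omega>. V \<omega> + W \<omega>) = \<Lambda> V + \<Lambda> W\<close> distrib_left)
  next
    case (seq U)
    have le: "U i \<omega> \<le> u \<omega>" if "\<omega> \<in> space M" for i \<omega>
      using seq(3,4) that by (intro incseq_le) (auto simp: incseq_def le_fun_def)
    have U: "U i \<in> Lp_space M p" for i
      using seq(1,2) le by (intro Lp_space_dominated[OF seq.prems]) (auto intro!: AE_I2 intro: order_trans[OF _ abs_ge_self])
    have "(\<lambda>i. \<Lambda> (\<lambda>\<omega>. u \<omega> - U i \<omega>)) \<longlonglongrightarrow> 0"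
    proof (rule conv[OF Lp_space_diff[OF seq.prems U] seq.prems])
      fix i \<omega> assume "\<omega> \<in> space M"
      then show "\<bar>u \<omega> - U i \<omega>\<bar> \<le> \<bar>u \<omega>\<bar>" using le[of \<omega> i] seq(2)[of i \<omega>] by simp
    next
      fix \<omega> assume "\<omega> \<in> space M"
      from tendsto_diff[OF tendsto_const seq(4)[OF this], of "u \<omega>"]
      show "(\<lambda>i. u \<omega> - U i \<omega>) \<longlonglongrightarrow> 0" by simp
    qed
    then have "(\<lambda>i. \<Lambda> u - (\<Lambda> u - \<Lambda> (U i))) \<longlonglongrightarrow> \<Lambda> u - 0" unfolding diff by (intro tendsto_diff tendsto_const)
    then have lim: "(\<lambda>i. \<integral>\<omega>. d \<omega> * U i \<omega> \<partial>M) \<longlonglongrightarrow> \<Lambda> u" using seq(5)[OF U] by simp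
    have *: "integrable M (\<lambda>\<omega>. d \<omega> * U i \<omega>)" "AE \<omega> in M. mono (\<lambda>n. d \<omega> * U n \<omega>)"
      "AE \<omega> in M. 0 \<le> d \<omega> * U i \<omega>" "AE \<omega> in M. (\<lambda>n. d \<omega> * U n \<omega>) \<longlonglongrightarrow> d \<omega> * u \<omega>" for i
      using seq(2,3,4) seq(5)[OF U] d0
      by (auto intro!: AE_I2 monoI mult_left_mono tendsto_mult_left simp: incseq_def le_fun_def)
    have [measurable]: "u \<in> borel_measurable M" by (rule Lp_space_measurable[OF seq.prems])
    have "(\<lambda>\<omega>. d \<omega> * u \<omega>) \<in> borel_measurable M" by measurable
    from integral_monotone_convergence_nonneg[OF * lim this]
    show ?case by simp
  qed
  have rep: "integrable M (\<lambda>\<omega>. d \<omega> * V \<omega>)" "\<Lambda> V = (\<integral>\<omega>. d \<omega> * V \<omega> \<partial>M)" if V: "V \<in> Lp_space M p" for V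
  proof -
    note [measurable] = Lp_space_measurable[OF V]
    let ?P = "\<lambda>\<omega>. max (V \<omega>) 0" and ?N = "\<lambda>\<omega>. max (- V \<omega>) 0"
    have "?P \<in> Lp_space M p" "?N \<in> Lp_space M p"
      by (auto intro!: Lp_space_dominated[OF V] AE_I2)
    then have P: "integrable M (\<lambda>\<omega>. d \<omega> * ?P \<omega>) \<and> \<Lambda> ?P = (\<integral>\<omega>. d \<omega> * ?P \<omega> \<partial>M)"
      and N: "integrable M (\<lambda>\<omega>. d \<omega> * ?N \<omega>) \<and> \<Lambda> ?N = (\<integral>\<omega>. d \<omega> * ?N \<omega> \<partial>M)"
      using nonneg[of ?P] nonneg[of ?N] by auto
    have V_eq: "V = (\<lambda>\<omega>. ?P \<omega> - ?N \<omega>)" by (auto simp: max_def)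
    have dV: "d \<omega> * V \<omega> = d \<omega> * ?P \<omega> - d \<omega> * ?N \<omega>" for \<omega> by (auto simp: max_def)
    show "integrable M (\<lambda>\<omega>. d \<omega> * V \<omega>)" unfolding dV using P N by (intro Bochner_Integration.integrable_diff) simp_all
    have "\<Lambda> V = \<Lambda> (\<lambda>\<omega>. ?P \<omega> - ?N \<omega>)" by (rule arg_cong[OF V_eq, of \<Lambda>])
    also have "\<dots> = \<Lambda> ?P - \<Lambda> ?N" by (rule diff)
    finally have "\<Lambda> V = \<Lambda> ?P - \<Lambda> ?N" .
    then show "\<Lambda> V = (\<integral>\<omega>. d \<omega> * V \<omega> \<partial>M)" 
      unfolding dV using P N by (simp add: Bochner_Integration.integral_diff)
  qed
  have "d \<in> Lp_space M q" by (rule Lp_space_conjugateI[OF p(1,3) _ d0 rep(1)]) simp_all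
  then show ?thesis using that d0 rep(2) by blast
qed

section \<open>Subgradients in a separable Banach space\<close>

lemma linear_dominated_bounded_linear:
  fixes l a :: "'b::real_normed_vector \<Rightarrow> real"
  assumes lin: "linear l" and le: "\<And>y. l y \<le> a y" and cont: "isCont a 0" and a0: "a 0 = 0"
  shows "bounded_linear l"
proof -
  interpret linear l by (rule lin)
  obtain \<delta> where \<delta>: "0 < \<delta>" "\<And>y. norm y < \<delta> \<Longrightarrow> \<bar>a y\<bar> < 1"
    using cont a0 unfolding continuous_at_eps_delta by (auto simp: dist_norm dest!: spec[of _ 1])
  have "l y \<le> norm y * (2 / \<delta>)" for y
  proof (cases "y = 0")
    case False
    let ?c = "\<delta> / (2 * norm y)"
    have "norm (?c *\<^sub>R y) < \<delta>" using False \<delta> by simp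
    then have "?c * l y < 1" using le[of "?c *\<^sub>R y"] \<delta>(2)[of "?c *\<^sub>R y"] by (simp add: scale)
    then show ?thesis using False \<delta> by (simp add: field_simps)
  qed (simp add: zero)
  from this[of "y" for y] this[of "- y" for y] have "\<bar>l y\<bar> \<le> norm y * (2 / \<delta>)" for y
    by (smt (verit) neg norm_minus_cancel)
  then show ?thesis by (intro bounded_linear_intro[where K = "2 / \<delta>"]) (auto simp: add scale)
qed

lemma subdifferential_nonempty:
  fixes h :: "'b::real_normed_vector \<Rightarrow> real"
  assumes conv: "convex_on UNIV h" and cont: "isCont h y"
  shows "subdifferential h y \<noteq> {}"
proof -
  obtain l where l: "linear l" "\<And>z. h y + l (z - y) \<le> h z"
    using convex_on_linear_support[OF conv subspace_UNIV, of y] by auto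
  have "bounded_linear l"
  proof (rule linear_dominated_bounded_linear[OF l(1)])
    show "l z \<le> h (y + z) - h y" for z using l(2)[of "y + z"] by simp
    have "isCont (\<lambda>z. h (y + z)) 0" using cont by (intro isCont_o2[where f = "\<lambda>z. y + z" and g = h]) auto
    then show "isCont (\<lambda>z. h (y + z) - h y) 0" by (intro continuous_intros)
  qed simp
  then have "Blinfun l \<in> subdifferential h y"
    using l(2) by (auto simp: subdifferential_def bounded_linear_Blinfun_apply)
  then show ?thesis by auto
qed

lemma countable_dense_rational_subspace:
  obtains D :: "'b::{real_normed_vector, second_countable_topology} set"
  where "countable D" "closure D = UNIV" "\<And>d e. d \<in> D \<Longrightarrow> e \<in> D \<Longrightarrow> d + e \<in> D"
    "\<And>c d. c \<in> \<rat> \<Longrightarrow> d \<in> D \<Longrightarrow> c *\<^sub>R d \<in> D"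
proof -
  obtain B :: "'b set" where B: "countable B" "\<And>X. open X \<Longrightarrow> X \<noteq> {} \<Longrightarrow> \<exists>d\<in>B. d \<in> X"
    using countable_dense_exists by auto
  let ?s = "\<lambda>xs :: (real \<times> 'b) list. \<Sum>x\<leftarrow>xs. fst x *\<^sub>R snd x"
  define D where "D = ?s ` lists (\<rat> \<times> B)"
  have "countable D"
    unfolding D_def by (intro countable_image countable_lists countable_SIGMA countable_rat B)
  moreover have "closure D = UNIV"
  proof -
    have "B \<subseteq> D"
    proof
      fix b assume "b \<in> B"
      then have "[(1, b)] \<in> lists (\<rat> \<times> B)" by simp
      then have "?s [(1, b)] \<in> D" unfolding D_def by (rule imageI)
      then show "b \<in> D" by simp
    qed
    moreover have "closure B = UNIV"
    proof (rule ccontr)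
      assume "closure B \<noteq> UNIV"
      then have "open (- closure B)" "- closure B \<noteq> {}" by auto
      with B(2) obtain d where "d \<in> B" "d \<in> - closure B" by blast
      then show False using closure_subset[of B] by auto
    qed
    ultimately show ?thesis using closure_mono[of B D] by auto
  qed
  moreover have "d + e \<in> D" if de: "d \<in> D" "e \<in> D" for d e
  proof -
    obtain xs ys where "xs \<in> lists (\<rat> \<times> B)" "ys \<in> lists (\<rat> \<times> B)" "d = ?s xs" "e = ?s ys"
      using de by (auto simp: D_def)
    then have "d + e = ?s (xs @ ys)" "xs @ ys \<in> lists (\<rat> \<times> B)" by simp_all
    then show ?thesis unfolding D_def by (rule image_eqI)
  qed
  moreover have "c *\<^sub>R d \<in> D" if cd: "c \<in> \<rat>" "d \<in> D" for c d
  proof -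
    obtain xs where xs: "xs \<in> lists (\<rat> \<times> B)" "d = ?s xs" using cd by (auto simp: D_def)
    have "c *\<^sub>R ?s xs = ?s (map (\<lambda>x. (c * fst x, snd x)) xs)" by (induction xs) (auto simp: scaleR_add_right)
    moreover have "map (\<lambda>x. (c * fst x, snd x)) xs \<in> lists (\<rat> \<times> B)"
      using xs(1) cd(1) by (auto simp: in_lists_conv_set)
    ultimately show ?thesis unfolding D_def xs(2) by (rule image_eqI)
  qed
  ultimately show ?thesis using that by blast
qed

text \<open>
  The bound by \<open>a\<close>, applied to \<open>d - e\<close> and to \<open>e - d\<close>, makes \<open>u\<close> uniformly continuous on \<open>D\<close>. Its continuous
  extension is additive and real homogeneous because these identities are closed conditions and hold on
  the dense sets \<open>D \<times> D\<close> and \<open>\<rat> \<times> D\<close>. The lemma is meant for a countable \<open>D\<close>, on which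
  a functional can be assembled from values that are determined only almost everywhere.
\<close>
lemma rational_linear_extension:
  fixes u a :: "'b::real_normed_vector \<Rightarrow> real"
  assumes dense: "closure D = UNIV"
    and Dadd: "\<And>d e. d \<in> D \<Longrightarrow> e \<in> D \<Longrightarrow> d + e \<in> D"
    and Dscale: "\<And>c d. c \<in> \<rat> \<Longrightarrow> d \<in> D \<Longrightarrow> c *\<^sub>R d \<in> D"
    and add: "\<And>d e. d \<in> D \<Longrightarrow> e \<in> D \<Longrightarrow> u (d + e) = u d + u e"
    and scale: "\<And>c d. c \<in> \<rat> \<Longrightarrow> d \<in> D \<Longrightarrow> u (c *\<^sub>R d) = c * u d"
    and le: "\<And>d. d \<in> D \<Longrightarrow> u d \<le> a d"
    and cont: "isCont a 0" and a0: "a 0 = 0"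
  obtains v :: "'b \<Rightarrow>\<^sub>L real" where "\<And>d. d \<in> D \<Longrightarrow> blinfun_apply v d = u d"
proof -
  have minus: "- d \<in> D" "u (- d) = - u d" if "d \<in> D" for d
    using Dscale[of "-1" d] scale[of "-1" d] that by auto
  have diff: "d - e \<in> D" "u (d - e) = u d - u e" if "d \<in> D" "e \<in> D" for d e
    using Dadd[of d "- e"] add[of d "- e"] minus[of e] that by auto
  have unif: "uniformly_continuous_on D u"
    unfolding uniformly_continuous_on_def
  proof (intro allI impI)
    fix \<epsilon> :: real assume "0 < \<epsilon>"
    then obtain \<delta> where \<delta>: "0 < \<delta>" "\<And>y. norm y < \<delta> \<Longrightarrow> \<bar>a y\<bar> < \<epsilon>"
      using cont a0 unfolding continuous_at_eps_delta by (auto simp: dist_norm)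
    have "dist (u d) (u e) < \<epsilon>" if "d \<in> D" "e \<in> D" "dist d e < \<delta>" for d e
    proof -
      have "\<bar>a (d - e)\<bar> < \<epsilon>" "\<bar>a (e - d)\<bar> < \<epsilon>"
        using that \<delta>(2) by (auto simp: dist_norm norm_minus_commute)
      moreover have "u d - u e \<le> a (d - e)" "u e - u d \<le> a (e - d)"
        using diff[of d e] diff[of e d] le[of "d - e"] le[of "e - d"] that by auto
      ultimately show ?thesis by (simp add: dist_real_def)
    qed
    then show "\<exists>\<delta>>0. \<forall>x\<in>D. \<forall>x'\<in>D. dist x' x < \<delta> \<longrightarrow> dist (u x') (u x) < \<epsilon>"
      using \<delta>(1) by blast
  qed
  obtain w where w: "uniformly_continuous_on (closure D) w" "\<And>d. d \<in> D \<Longrightarrow> u d = w d"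
    using uniformly_continuous_on_extension_on_closure[OF unif] by metis
  have wc: "continuous_on UNIV w" using w(1) dense uniformly_continuous_imp_continuous by metis
  have wadd: "w (y + z) = w y + w z" for y z
  proof -
    have "continuous_on (closure (D \<times> D)) (\<lambda>x. w (fst x + snd x) - w (fst x) - w (snd x))"
      by (intro continuous_intros continuous_on_compose2[OF wc]) auto
    then have "w (fst (y, z) + snd (y, z)) - w (fst (y, z)) - w (snd (y, z)) = 0"
      by (rule continuous_constant_on_closure) (use Dadd add w(2) dense in \<open>auto simp: closure_Times\<close>)
    then show ?thesis by simp
  qed
  have wscale: "w (c *\<^sub>R y) = c * w y" for c y
  proof -
    have "continuous_on (closure (\<rat> \<times> D)) (\<lambda>x. w (fst x *\<^sub>R snd x) - fst x * w (snd x))"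
      by (intro continuous_intros continuous_on_compose2[OF wc]) auto
    then have "w (fst (c, y) *\<^sub>R snd (c, y)) - fst (c, y) * w (snd (c, y)) = 0"
      by (rule continuous_constant_on_closure)
        (use Dscale scale w(2) dense Rats_closure_real in \<open>auto simp: closure_Times\<close>)
    then show ?thesis by simp
  qed
  have lin: "linear w" by (intro linearI) (auto simp: wadd wscale)
  have "isCont w 0" using wc by (simp add: continuous_on_eq_continuous_at)
  then have "bounded_linear w"
    using linear_0[OF lin] by (intro linear_dominated_bounded_linear[OF lin, of w]) auto
  then show ?thesis using that[of "Blinfun w"] w(2) by (simp add: bounded_linear_Blinfun_apply)
qed

section \<open>Functions with values in the dual space\<close>

text \<open>
  The map \<open>(\<omega>, y) \<mapsto> g \<omega> y\<close> is measurable in \<open>\<omega>\<close> and continuous in \<open>y\<close>, so \<open>h\<close> may be replaced by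
  functions with finitely many values.
\<close>
lemma borel_measurable_weakly_measurable_apply:
  fixes g :: "'a \<Rightarrow> ('b::{real_normed_vector, second_countable_topology} \<Rightarrow>\<^sub>L real)"
  assumes g: "\<And>y. (\<lambda>\<omega>. blinfun_apply (g \<omega>) y) \<in> borel_measurable M" and h: "h \<in> borel_measurable M"
  shows "(\<lambda>\<omega>. blinfun_apply (g \<omega>) (h \<omega>)) \<in> borel_measurable M"
proof -
  obtain s where s: "\<And>i. simple_function M (s i)" "\<And>\<omega>. \<omega> \<in> space M \<Longrightarrow> (\<lambda>i. s i \<omega>) \<longlonglongrightarrow> h \<omega>"
    using borel_measurable_implies_sequence_metric[OF h, of 0] by blast
  have "(\<lambda>\<omega>. blinfun_apply (g \<omega>) (s i \<omega>)) \<in> borel_measurable M" for i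
  proof (rule measurable_compose_countable'[where I = "s i ` space M" and g = "s i"])
    show "s i \<in> measurable M (count_space (s i ` space M))"
      using s(1)[of i] by (auto simp: simple_function_def measurable_count_space_eq2)
    show "countable (s i ` space M)" using s(1)[of i] by (auto simp: simple_function_def intro: countable_finite)
  qed (rule g)
  then show ?thesis
  proof (rule borel_measurable_LIMSEQ_real[rotated])
    show "(\<lambda>i. blinfun_apply (g \<omega>) (s i \<omega>)) \<longlonglongrightarrow> blinfun_apply (g \<omega>) (h \<omega>)" if "\<omega> \<in> space M" for \<omega>
      using s(2)[OF that] by (intro tendsto_intros)
  qed
qed

lemma dense_sequence_norming:
  fixes v :: "'b::real_normed_vector \<Rightarrow>\<^sub>L real" and e :: "nat \<Rightarrow> 'b"
  assumes e: "\<And>X. open X \<Longrightarrow> X \<noteq> {} \<Longrightarrow> \<exists>n. e n \<in> X" and c: "c < norm v"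
  shows "\<exists>n. norm (e n) \<le> 1 \<and> c < blinfun_apply v (e n)"
proof -
  have "\<exists>y. norm y < 1 \<and> c < blinfun_apply v y"
  proof (cases "c < 0")
    case True
    then show ?thesis by (intro exI[of _ 0]) (simp add: blinfun.zero_right)
  next
    case False
    then have c0: "0 \<le> c" by simp
    obtain y where y: "c * norm y < \<bar>blinfun_apply v y\<bar>"
    proof (rule ccontr)
      assume "\<not> thesis"
      then have "\<And>y. \<bar>blinfun_apply v y\<bar> \<le> c * norm y" using that by (meson not_less)
      then have "norm v \<le> c" using c0 by (intro norm_blinfun_bound) auto
      then show False using c by simp
    qed
    obtain z where z: "c * norm z < blinfun_apply v z"
    proof (cases "0 \<le> blinfun_apply v y")
      case True
      then show ?thesis using y that[of y] by simp
    next
      case False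
      then show ?thesis using y that[of "- y"] by (simp add: blinfun.minus_right)
    qed
    then have nz: "0 < norm z" by (auto simp: blinfun.zero_right)
    obtain t where t: "c * norm z < t * blinfun_apply v z" "0 < t" "t < 1"
    proof -
      have vz: "0 < blinfun_apply v z" using z c0 nz by (smt (verit) mult_nonneg_nonneg)
      obtain t where "max 0 (c * norm z / blinfun_apply v z) < t" "t < 1"
        using dense[of "max 0 (c * norm z / blinfun_apply v z)" 1] z vz by (auto simp: field_simps)
      then show ?thesis using vz by (intro that[of t]) (auto simp: field_simps)
    qed
    show ?thesis
      using t nz by (intro exI[of _ "(t / norm z) *\<^sub>R z"]) (simp add: blinfun.scaleR_right field_simps)
  qed
  then have "{y. norm y < 1} \<inter> {y. c < blinfun_apply v y} \<noteq> {}" by auto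
  moreover have "open ({y. norm y < 1} \<inter> {y. c < blinfun_apply v y})"
    by (intro open_Int open_Collect_less continuous_intros)
  ultimately obtain n where "e n \<in> {y. norm y < 1} \<inter> {y. c < blinfun_apply v y}" using e by blast
  then show ?thesis by (intro exI[of _ n]) auto
qed

lemma dense_sequence_exists:
  obtains e :: "nat \<Rightarrow> 'b::second_countable_topology"
  where "\<And>X. open X \<Longrightarrow> X \<noteq> {} \<Longrightarrow> \<exists>n. e n \<in> X"
proof -
  obtain B :: "'b set" where B: "countable B" "\<And>X. open X \<Longrightarrow> X \<noteq> {} \<Longrightarrow> \<exists>d\<in>B. d \<in> X"
    using countable_dense_exists by auto
  have "B \<noteq> {}" using B(2)[of UNIV] by auto
  then have "range (from_nat_into B) = B" using B(1) by (rule range_from_nat_into)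
  then show ?thesis using B(2) that[of "from_nat_into B"] by (metis imageE)
qed

lemma borel_measurable_weakly_measurable_norm:
  fixes g :: "'a \<Rightarrow> ('b::{real_normed_vector, second_countable_topology} \<Rightarrow>\<^sub>L real)"
  assumes g[measurable]: "\<And>y. (\<lambda>\<omega>. blinfun_apply (g \<omega>) y) \<in> borel_measurable M"
  shows "(\<lambda>\<omega>. norm (g \<omega>)) \<in> borel_measurable M"
proof -
  obtain e :: "nat \<Rightarrow> 'b" where e: "\<And>X. open X \<Longrightarrow> X \<noteq> {} \<Longrightarrow> \<exists>n. e n \<in> X"
    by (rule dense_sequence_exists) blast
  have "c < norm (g \<omega>) \<longleftrightarrow> (\<exists>n. norm (e n) \<le> 1 \<and> c < blinfun_apply (g \<omega>) (e n))" for c \<omega>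
  proof
    assume "\<exists>n. norm (e n) \<le> 1 \<and> c < blinfun_apply (g \<omega>) (e n)"
    then obtain n where n: "norm (e n) \<le> 1" "c < blinfun_apply (g \<omega>) (e n)" by blast
    have "blinfun_apply (g \<omega>) (e n) \<le> norm (g \<omega>) * norm (e n)"
      using norm_blinfun[of "g \<omega>" "e n"] by simp
    also have "\<dots> \<le> norm (g \<omega>)" using n(1) by (simp add: mult_left_le)
    finally show "c < norm (g \<omega>)" using n(2) by simp
  qed (rule dense_sequence_norming[OF e])
  then show ?thesis by (simp add: borel_measurable_iff_greater)
qed

text \<open>
  The selection takes the first suitable point of a dense sequence. The factor \<open>1 / 2\<close> leaves room for
  such a point to exist, since the norm of a functional need not be attained.
\<close>
lemma measurable_norming_selection:
  fixes g :: "'a \<Rightarrow> ('b::{real_normed_vector, second_countable_topology} \<Rightarrow>\<^sub>L real)"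
  assumes g[measurable]: "\<And>y. (\<lambda>\<omega>. blinfun_apply (g \<omega>) y) \<in> borel_measurable M"
  obtains y where "y \<in> borel_measurable M" "\<And>\<omega>. norm (y \<omega>) \<le> 1"
    "\<And>\<omega>. norm (g \<omega>) / 2 \<le> blinfun_apply (g \<omega>) (y \<omega>)"
proof -
  obtain e :: "nat \<Rightarrow> 'b" where e: "\<And>X. open X \<Longrightarrow> X \<noteq> {} \<Longrightarrow> \<exists>n. e n \<in> X"
    by (rule dense_sequence_exists) blast
  note [measurable] = borel_measurable_weakly_measurable_norm[OF g]
  let ?P = "\<lambda>\<omega> n. norm (e n) \<le> 1 \<and> norm (g \<omega>) / 2 \<le> blinfun_apply (g \<omega>) (e n)"
  have ex: "\<exists>n. ?P \<omega> n" for \<omega>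
  proof (cases "g \<omega> = 0")
    case True
    obtain n where "e n \<in> ball 0 1" using e[of "ball 0 1"] by auto
    then show ?thesis using True by (intro exI[of _ n]) (auto simp: blinfun.zero_left)
  next
    case False
    then show ?thesis using dense_sequence_norming[OF e, of "norm (g \<omega>) / 2" "g \<omega>"]
      by (auto intro: less_imp_le)
  qed
  define N where "N \<omega> = (LEAST n. ?P \<omega> n)" for \<omega>
  have [measurable]: "N \<in> measurable M (count_space UNIV)" unfolding N_def by measurable
  have "?P \<omega> (N \<omega>)" for \<omega> unfolding N_def using ex by (rule LeastI_ex)
  then show ?thesis by (intro that[of "\<lambda>\<omega>. e (N \<omega>)"]) auto
qed

lemma Lp_space_dual_valued_integrable:
  fixes g :: "'a \<Rightarrow> ('b::{real_normed_vector, second_countable_topology} \<Rightarrow>\<^sub>L real)"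
  assumes p: "1 \<le> p" "1 / p + 1 / q = 1" and g: "g \<in> Lp_space_dual_valued M q" and h: "h \<in> Lp_space M p"
  shows "integrable M (\<lambda>\<omega>. blinfun_apply (g \<omega>) (h \<omega>))"
    "\<bar>\<integral>\<omega>. blinfun_apply (g \<omega>) (h \<omega>) \<partial>M\<bar> \<le> (\<integral>\<omega>. norm (g \<omega>) * norm (h \<omega>) \<partial>M)"
proof -
  note [measurable] = Lp_space_measurable[OF h]
  have h': "(\<lambda>\<omega>. norm (h \<omega>)) \<in> Lp_space M p" using h by (simp add: Lp_space_norm_iff)
  have gm: "(\<lambda>\<omega>. blinfun_apply (g \<omega>) y) \<in> borel_measurable M" for y
    using g unfolding Lp_space_dual_valued_def by blast
  have gq: "(\<lambda>\<omega>. norm (g \<omega>)) \<in> Lp_space M q"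
    using g unfolding Lp_space_dual_valued_def by blast
  have m: "(\<lambda>\<omega>. blinfun_apply (g \<omega>) (h \<omega>)) \<in> borel_measurable M"
    by (rule borel_measurable_weakly_measurable_apply[OF gm Lp_space_measurable[OF h]])
  have int: "integrable M (\<lambda>\<omega>. norm (g \<omega>) * norm (h \<omega>))"
    using integrable_product_conjugate[OF p h' gq] by (simp add: mult.commute)
  have le: "norm (blinfun_apply (g \<omega>) (h \<omega>)) \<le> norm (g \<omega>) * norm (h \<omega>)" for \<omega> by (rule norm_blinfun)
  show i: "integrable M (\<lambda>\<omega>. blinfun_apply (g \<omega>) (h \<omega>))"
    using le by (intro Bochner_Integration.integrable_bound[OF int m] AE_I2) (simp add: abs_mult)
  show "\<bar>\<integral>\<omega>. blinfun_apply (g \<omega>) (h \<omega>) \<partial>M\<bar> \<le> (\<integral>\<omega>. norm (g \<omega>) * norm (h \<omega>) \<partial>M)"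
    by (rule order_trans[OF integral_abs_bound Bochner_Integration.integral_mono])
      (use i int le in auto)
qed

text \<open>
  For \<open>p = \<infinity>\<close> the bound is the integral of \<open>\<omega> \<mapsto> norm (g \<omega>)\<close>; otherwise it is a bound of the positive functional
  \<open>\<beta> \<mapsto> \<integral>\<omega>. norm (g \<omega>) * \<beta> \<omega> \<partial>M\<close> on scalar functions.
\<close>
lemma (in prob_space) Lp_functional_in_dual:
  fixes g :: "'a \<Rightarrow> ('b::{real_normed_vector, second_countable_topology} \<Rightarrow>\<^sub>L real)"
  assumes p: "1 \<le> p" "1 / p + 1 / q = 1" and g: "g \<in> Lp_space_dual_valued M q"
  shows "Lp_functional M p g \<in> Lp_dual M p"
proof -
  note i = Lp_space_dual_valued_integrable[OF p g]
  have gq: "(\<lambda>\<omega>. norm (g \<omega>)) \<in> Lp_space M q" using g by (simp add: Lp_space_dual_valued_def)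
  have "\<exists>K. \<forall>h\<in>Lp_space M p. (\<integral>\<omega>. norm (g \<omega>) * norm (h \<omega> :: 'b) \<partial>M) \<le> K * Lp_norm M p h"
  proof (cases "p = \<infinity>")
    case True
    have q: "q = 1" using p by (cases rule: conjugate_exponent_cases) (use True in auto)
    have gi: "integrable M (\<lambda>\<omega>. norm (g \<omega>))" using gq by (simp add: q Lp_space_1_iff)
    show ?thesis
    proof (intro exI ballI)
      fix h :: "'a \<Rightarrow> 'b" assume h: "h \<in> Lp_space M p"
      have "(\<integral>\<omega>. norm (g \<omega>) * norm (h \<omega>) \<partial>M) \<le> (\<integral>\<omega>. norm (g \<omega>) * Lp_norm M p h \<partial>M)"
        using Lp_norm_top_bound[OF h[unfolded True]] gi
        by (intro integral_mono_AE') (auto intro!: mult_left_mono simp: True)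
      then show "(\<integral>\<omega>. norm (g \<omega>) * norm (h \<omega>) \<partial>M) \<le> (\<integral>\<omega>. norm (g \<omega>) \<partial>M) * Lp_norm M p h" by simp
    qed
  next
    case False
    then have fin: "p < \<infinity>" by (simp add: less_top)
    have int: "integrable M (\<lambda>\<omega>. norm (g \<omega>) * \<beta> \<omega>)" if "\<beta> \<in> Lp_space M p" for \<beta>
      using integrable_product_conjugate[OF p that gq] by (simp add: mult.commute)
    obtain C where C: "\<And>\<beta>. \<beta> \<in> Lp_space M p \<Longrightarrow> \<bar>\<integral>\<omega>. norm (g \<omega>) * \<beta> \<omega> \<partial>M\<bar> \<le> C * Lp_norm M p \<beta>"
      by (rule integral_against_nonneg_bounded[of p "\<lambda>\<omega>. norm (g \<omega>)" M, OF p(1) fin norm_ge_zero int]) blast+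
    show ?thesis
    proof (intro exI ballI)
      fix h :: "'a \<Rightarrow> 'b" assume h: "h \<in> Lp_space M p"
      then have "(\<lambda>\<omega>. norm (h \<omega>)) \<in> Lp_space M p" by (simp add: Lp_space_norm_iff Lp_space_measurable)
      from C[OF this] show "(\<integral>\<omega>. norm (g \<omega>) * norm (h \<omega>) \<partial>M) \<le> C * Lp_norm M p h"
        by (simp add: Lp_norm_norm)
    qed
  qed
  then obtain K where K: "\<And>h. h \<in> Lp_space M p \<Longrightarrow> (\<integral>\<omega>. norm (g \<omega>) * norm (h \<omega> :: 'b) \<partial>M) \<le> K * Lp_norm M p h"
    by blast
  show ?thesis
    unfolding Lp_dual_def
  proof (intro CollectI conjI ballI allI)
    fix h k :: "'a \<Rightarrow> 'b" assume "h \<in> Lp_space M p" "k \<in> Lp_space M p"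
    then show "Lp_functional M p g (\<lambda>\<omega>. h \<omega> + k \<omega>) = Lp_functional M p g h + Lp_functional M p g k"
      using i(1) by (simp add: Lp_functional_def Lp_space_add blinfun.add_right)
  next
    fix c and h :: "'a \<Rightarrow> 'b" assume "h \<in> Lp_space M p"
    then show "Lp_functional M p g (\<lambda>\<omega>. c *\<^sub>R h \<omega>) = c * Lp_functional M p g h"
      by (simp add: Lp_functional_def Lp_space_scaleR blinfun.scaleR_right)
  next
    show "\<exists>K. \<forall>h\<in>Lp_space M p. \<bar>Lp_functional M p g h\<bar> \<le> K * Lp_norm M p h"
      using order_trans[OF i(2) K] by (auto simp: Lp_functional_def)
  qed (simp add: Lp_functional_def)
qed

text \<open>
  If \<open>y\<close> is a norming selection of \<open>g\<close>, then \<open>norm (g \<omega>) * \<beta> \<omega>\<close> is controlled by \<open>2 * g \<omega> (\<beta> \<omega> *\<^sub>R y \<omega>)\<close>.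
  This reduces the claim to the scalar converse of the inequality of Hoelder.
\<close>
lemma (in prob_space) Lp_space_dual_valuedI:
  fixes g :: "'a \<Rightarrow> ('b::{real_normed_vector, second_countable_topology} \<Rightarrow>\<^sub>L real)"
  assumes p: "1 \<le> p" "1 / p + 1 / q = 1"
    and g: "\<And>y. (\<lambda>\<omega>. blinfun_apply (g \<omega>) y) \<in> borel_measurable M"
    and int: "\<And>h. h \<in> Lp_space M p \<Longrightarrow> integrable M (\<lambda>\<omega>. blinfun_apply (g \<omega>) (h \<omega>))"
  shows "g \<in> Lp_space_dual_valued M q"
proof -
  note [measurable] = borel_measurable_weakly_measurable_norm[OF g]
  obtain y where y[measurable]: "y \<in> borel_measurable M" and y1: "\<And>\<omega>. norm (y \<omega>) \<le> 1"
    and gy: "\<And>\<omega>. norm (g \<omega>) / 2 \<le> blinfun_apply (g \<omega>) (y \<omega>)"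
    using measurable_norming_selection[OF g] by metis
  have "(\<lambda>\<omega>. norm (g \<omega>)) \<in> Lp_space M q"
  proof (rule Lp_space_conjugateI[OF p])
    fix \<beta> :: "'a \<Rightarrow> real" assume \<beta>: "\<beta> \<in> Lp_space M p"
    note [measurable] = Lp_space_measurable[OF \<beta>]
    have "(\<lambda>\<omega>. \<beta> \<omega> *\<^sub>R y \<omega>) \<in> Lp_space M p"
      using y1 by (intro Lp_space_dominated[OF \<beta>]) (auto simp: mult_left_le)
    from int[OF this] have "integrable M (\<lambda>\<omega>. 2 * (\<beta> \<omega> * blinfun_apply (g \<omega>) (y \<omega>)))"
      by (simp add: blinfun.scaleR_right)
    then show "integrable M (\<lambda>\<omega>. norm (g \<omega>) * \<beta> \<omega>)"
    proof (rule Bochner_Integration.integrable_bound)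
      have "norm (norm (g \<omega>) * \<beta> \<omega>) \<le> norm (2 * (\<beta> \<omega> * blinfun_apply (g \<omega>) (y \<omega>)))" for \<omega>
      proof -
        have "norm (g \<omega>) \<le> 2 * \<bar>blinfun_apply (g \<omega>) (y \<omega>)\<bar>" using gy[of \<omega>] by linarith
        from mult_right_mono[OF this abs_ge_zero[of "\<beta> \<omega>"]] show ?thesis by (simp add: abs_mult mult_ac)
      qed
      then show "AE \<omega> in M. norm (norm (g \<omega>) * \<beta> \<omega>) \<le> norm (2 * (\<beta> \<omega> * blinfun_apply (g \<omega>) (y \<omega>)))" by simp
    qed measurable
  qed simp_all
  then show ?thesis using g by (simp add: Lp_space_dual_valued_def)
qed

section \<open>Multipliers for monotone compositions\<close>

text \<open>
  A linear function on \<open>S\<close> is convex, and a linear support of it at \<open>0\<close> agrees with it on \<open>S\<close>.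
\<close>
lemma linear_extension_from_subspace:
  fixes l :: "'v::real_vector \<Rightarrow> real"
  assumes S: "subspace S" and add: "\<And>h k. h \<in> S \<Longrightarrow> k \<in> S \<Longrightarrow> l (h + k) = l h + l k"
    and scale: "\<And>c h. h \<in> S \<Longrightarrow> l (c *\<^sub>R h) = c * l h"
  obtains l' where "linear l'" "\<And>h. h \<in> S \<Longrightarrow> l' h = l h"
proof -
  have "convex_on S l"
    using S by (intro convex_onI) (auto simp: add scale subspace_scale subspace_imp_convex)
  then obtain l' where l': "linear l'" "\<And>h. h \<in> S \<Longrightarrow> l 0 + l' (h - 0) \<le> l h"
    using convex_on_linear_support[OF _ S subspace_0[OF S]] by blast
  have l0: "l 0 = 0" using scale[OF subspace_0[OF S], of 0] by simp
  have "l' h = l h" if h: "h \<in> S" for h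
  proof -
    have "- h \<in> S" by (rule subspace_neg[OF S h])
    moreover have "l (- h) = - l h" using scale[OF h, of "-1"] by simp
    moreover have "l' (- h) = - l' h" using l'(1) by (rule linear_neg)
    ultimately show ?thesis using l'(2)[OF h] l'(2)[of "- h"] l0 by simp
  qed
  then show ?thesis using l'(1) that by blast
qed

text \<open>
  The multiplier is a subgradient at \<open>0\<close> of the perturbation function
  \<open>\<Psi> V = (INF h. \<rho> (F h + V) - l (h - x))\<close>. Convexity of \<open>F\<close> together with monotonicity and convexity
  of \<open>\<rho>\<close> makes the function under the infimum jointly convex in \<open>h\<close> and \<open>V\<close>, so \<open>\<Psi>\<close> is convex, and \<open>\<Psi> 0 = \<rho> (F x)\<close> because \<open>l\<close> is a subgradient of
  the composition. For a subgradient \<open>\<Lambda>\<close> the inequality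
  \<open>\<rho> (F x) + \<Lambda> V \<le> \<rho> (F h + V) - l (h - x)\<close> holds for all \<open>h\<close> and \<open>V\<close>. With \<open>h = x\<close> it says that \<open>\<Lambda>\<close> is a
  positive functional and a subgradient of \<open>\<rho>\<close> at \<open>F x\<close>, and with \<open>V = F x - F h\<close> it is the last claim.
\<close>
lemma (in prob_space) monotone_composition_multiplier:
  fixes F :: "('a \<Rightarrow> 'b::{banach, second_countable_topology}) \<Rightarrow> ('a \<Rightarrow> real)"
  assumes p: "1 \<le> p" "p < \<infinity>" "1 / p + 1 / q = 1"
    and F: "\<And>h. h \<in> Lp_space M r \<Longrightarrow> F h \<in> Lp_space M p"
    and Fconv: "\<And>h k t. h \<in> Lp_space M r \<Longrightarrow> k \<in> Lp_space M r \<Longrightarrow> 0 \<le> t \<Longrightarrow> t \<le> 1 \<Longrightarrow>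
      AE \<omega> in M. F ((1 - t) *\<^sub>R h + t *\<^sub>R k) \<omega> \<le> (1 - t) * F h \<omega> + t * F k \<omega>"
    and conv: "Lp_convex M p \<rho>" and mono: "Lp_nondecreasing M p \<rho>"
    and x: "x \<in> Lp_space M r"
    and l: "linear l" "\<And>h. h \<in> Lp_space M r \<Longrightarrow> \<rho> (F x) + l (h - x) \<le> \<rho> (F h)"
  obtains \<zeta> where "\<zeta> \<in> Lp_subdifferential_pairing M p q \<rho> (F x)" "\<And>\<omega>. 0 \<le> \<zeta> \<omega>"
    "\<And>h. h \<in> Lp_space M r \<Longrightarrow> l (h - x) \<le> (\<integral>\<omega>. \<zeta> \<omega> * (F h \<omega> - F x \<omega>) \<partial>M)"
proof -
  let ?X = "Lp_space M r :: ('a \<Rightarrow> 'b) set" and ?Y = "Lp_space M p :: ('a \<Rightarrow> real) set"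
  have sX: "subspace ?X" and sY: "subspace ?Y" by (rule subspace_Lp_space)+
  interpret l: linear l by (rule l)
  have \<rho>conv: "\<rho> ((1 - t) *\<^sub>R Z + t *\<^sub>R V) \<le> (1 - t) * \<rho> Z + t * \<rho> V"
    if "Z \<in> ?Y" "V \<in> ?Y" "0 \<le> t" "t \<le> 1" for Z V t
    using conv that by (simp add: Lp_convex_def plus_fun_def scaleR_fun_def)
  have \<rho>mono: "\<rho> Z \<le> \<rho> V" if "Z \<in> ?Y" "V \<in> ?Y" "AE \<omega> in M. Z \<omega> \<le> V \<omega>" for Z V
    using mono that by (auto simp: Lp_nondecreasing_def)
  define J where "J = (\<lambda>(h, V). \<rho> (F h + V) - l (h - x))"
  define \<Psi> where "\<Psi> V = (INF h\<in>?X. J (h, V))" for V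
  note cl = subspace_add[OF sY] subspace_diff[OF sY] subspace_scale[OF sY] F
    subspace_add[OF sX] subspace_diff[OF sX] subspace_scale[OF sX]
  \<comment> \<open>The pairs \<open>(h, V)\<close> and \<open>(x, - V)\<close> have a midpoint with second component \<open>0\<close>,
    where the subgradient inequality for \<open>l\<close> bounds \<open>J\<close> from below.\<close>
  have lower: "2 * \<rho> (F x) - \<rho> (F x - V) \<le> J (h, V)" if h: "h \<in> ?X" and V: "V \<in> ?Y" for h V
  proof -
    let ?m = "(1 - 1/2) *\<^sub>R h + (1/2) *\<^sub>R x"
    have m: "?m \<in> ?X" using h x by (intro cl)
    have "l (?m - x) = l (h - x) / 2"
      by (simp only: l.add l.diff l.scale) (simp add: field_simps)
    then have "\<rho> (F x) + l (h - x) / 2 \<le> \<rho> (F ?m)" using l(2)[OF m] by simp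
    also have "\<dots> \<le> \<rho> ((1 - 1/2) *\<^sub>R (F h + V) + (1/2) *\<^sub>R (F x - V))"
    proof (rule \<rho>mono)
      show "AE \<omega> in M. F ?m \<omega> \<le> ((1 - 1/2) *\<^sub>R (F h + V) + (1/2) *\<^sub>R (F x - V)) \<omega>"
        using Fconv[OF h x, of "1/2"] by (auto simp: field_simps elim: eventually_mono)
    qed (intro cl h x V m)+
    also have "\<dots> \<le> (1 - 1/2) * \<rho> (F h + V) + (1/2) * \<rho> (F x - V)"
      using h V x by (intro \<rho>conv cl) auto
    finally show ?thesis by (simp add: J_def)
  qed
  have bdd: "bdd_below ((\<lambda>h. J (h, V)) ` ?X)" if "V \<in> ?Y" for V
    using lower[OF _ that] by (intro bdd_belowI2)
  have "convex_on (?X \<times> ?Y) J"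
  proof (rule convex_onI)
    fix t :: real and z w assume t: "0 < t" "t < 1" and "z \<in> ?X \<times> ?Y" "w \<in> ?X \<times> ?Y"
    then obtain h V k W where z: "z = (h, V)" "h \<in> ?X" "V \<in> ?Y" and w: "w = (k, W)" "k \<in> ?X" "W \<in> ?Y"
      by auto
    have "\<rho> (F ((1 - t) *\<^sub>R h + t *\<^sub>R k) + ((1 - t) *\<^sub>R V + t *\<^sub>R W))
        \<le> \<rho> ((1 - t) *\<^sub>R (F h + V) + t *\<^sub>R (F k + W))"
    proof (rule \<rho>mono)
      show "AE \<omega> in M. (F ((1 - t) *\<^sub>R h + t *\<^sub>R k) + ((1 - t) *\<^sub>R V + t *\<^sub>R W)) \<omega>
          \<le> ((1 - t) *\<^sub>R (F h + V) + t *\<^sub>R (F k + W)) \<omega>"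
        using Fconv[OF z(2) w(2), of t] t by (auto simp: algebra_simps elim: eventually_mono)
    qed (intro cl z w)+
    also have "\<dots> \<le> (1 - t) * \<rho> (F h + V) + t * \<rho> (F k + W)"
      using t z w by (intro \<rho>conv cl) auto
    finally have *: "\<rho> (F ((1 - t) *\<^sub>R h + t *\<^sub>R k) + ((1 - t) *\<^sub>R V + t *\<^sub>R W))
      \<le> (1 - t) * \<rho> (F h + V) + t * \<rho> (F k + W)" .
    have "l ((1 - t) *\<^sub>R h + t *\<^sub>R k - x) = (1 - t) * l (h - x) + t * l (k - x)"
      by (simp only: l.add l.diff l.scale) (simp add: algebra_simps)
    then show "J ((1 - t) *\<^sub>R z + t *\<^sub>R w) \<le> (1 - t) * J z + t * J w"
      using * by (simp add: J_def z w right_diff_distrib)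
  qed (use sX sY in \<open>simp add: convex_Times subspace_imp_convex\<close>)
  then have "convex_on ?Y \<Psi>"
    unfolding \<Psi>_def using x sX sY by (intro convex_on_INF_marginal bdd) (auto simp: subspace_imp_convex)
  then obtain \<Lambda> where \<Lambda>: "linear \<Lambda>" "\<And>V. V \<in> ?Y \<Longrightarrow> \<Psi> 0 + \<Lambda> (V - 0) \<le> \<Psi> V"
    using convex_on_linear_support[OF _ sY subspace_0[OF sY]] by blast
  interpret \<Lambda>: linear \<Lambda> by (rule \<Lambda>)
  have "\<rho> (F x) \<le> \<Psi> 0"
    unfolding \<Psi>_def using l(2) x by (intro cINF_greatest) (auto simp: J_def le_diff_eq)
  then have \<Lambda>J: "\<rho> (F x) + \<Lambda> V \<le> J (h, V)" if "h \<in> ?X" "V \<in> ?Y" for h V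
    using \<Lambda>(2)[OF that(2)] cINF_lower[OF bdd[OF that(2)] that(1)] unfolding \<Psi>_def by simp
  obtain \<zeta> where \<zeta>: "\<zeta> \<in> Lp_space M q" "\<And>\<omega>. 0 \<le> \<zeta> \<omega>" "\<And>V. V \<in> ?Y \<Longrightarrow> \<Lambda> V = (\<integral>\<omega>. \<zeta> \<omega> * V \<omega> \<partial>M)"
  proof (rule positive_functional_representation[OF p \<Lambda>(1)])
    fix V W assume V: "V \<in> ?Y" and W: "W \<in> ?Y" and le: "AE \<omega> in M. V \<omega> \<le> W \<omega>"
    have "\<rho> (F x + (V - W)) \<le> \<rho> (F x)"
      using le by (intro \<rho>mono cl x V W) (auto elim: eventually_mono)
    then have "\<Lambda> (V - W) \<le> 0" using \<Lambda>J[OF x, of "V - W"] V W by (simp add: J_def cl l.zero)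
    then show "\<Lambda> V \<le> \<Lambda> W" by (simp add: \<Lambda>.diff)
  qed blast
  have "\<zeta> \<in> Lp_subdifferential_pairing M p q \<rho> (F x)"
    unfolding Lp_subdifferential_pairing_def
  proof (intro CollectI conjI ballI \<zeta>(1))
    fix V assume V: "V \<in> ?Y"
    have "V - F x \<in> ?Y" by (intro cl V x)
    from \<Lambda>J[OF x this] \<zeta>(3)[OF this] show "\<rho> (F x) + (\<integral>\<omega>. \<zeta> \<omega> * (V \<omega> - F x \<omega>) \<partial>M) \<le> \<rho> V"
      by (simp add: J_def l.zero)
  qed
  moreover have "l (h - x) \<le> (\<integral>\<omega>. \<zeta> \<omega> * (F h \<omega> - F x \<omega>) \<partial>M)" if h: "h \<in> ?X" for h
  proof -
    have V: "F x - F h \<in> ?Y" "F h - F x \<in> ?Y" by (intro cl h x)+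
    have "\<Lambda> (F x - F h) = - \<Lambda> (F h - F x)" by (simp add: \<Lambda>.diff)
    then show ?thesis using \<Lambda>J[OF h V(1)] \<zeta>(3)[OF V(2)] by (simp add: J_def)
  qed
  ultimately show ?thesis using that \<zeta>(2) by blast
qed

section \<open>Integral functionals below a superposition operator\<close>

lemma AE_le_if_integrals_le:
  fixes u v :: "'a \<Rightarrow> real"
  assumes u: "integrable M u" and v: "integrable M v"
    and le: "\<And>A. A \<in> sets M \<Longrightarrow> (\<integral>\<omega>. indicator A \<omega> * u \<omega> \<partial>M) \<le> (\<integral>\<omega>. indicator A \<omega> * v \<omega> \<partial>M)"
  shows "AE \<omega> in M. u \<omega> \<le> v \<omega>"
proof -
  note [measurable] = borel_measurable_integrable[OF u] borel_measurable_integrable[OF v]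
  define A where "A = {\<omega>\<in>space M. v \<omega> < u \<omega>}"
  have A: "A \<in> sets M" unfolding A_def by measurable
  note i = integrable_real_mult_indicator[OF A u] integrable_real_mult_indicator[OF A v]
  have i': "integrable M (\<lambda>\<omega>. u \<omega> * indicator A \<omega> - v \<omega> * indicator A \<omega>)"
    using i by (intro Bochner_Integration.integrable_diff)
  have nn: "0 \<le> u \<omega> * indicator A \<omega> - v \<omega> * indicator A \<omega>" for \<omega>
    by (auto simp: A_def indicator_def)
  have "(\<integral>\<omega>. u \<omega> * indicator A \<omega> - v \<omega> * indicator A \<omega> \<partial>M) \<le> 0"
    using le[OF A] Bochner_Integration.integral_diff[OF i] by (simp add: mult.commute)
  then have "(\<integral>\<omega>. u \<omega> * indicator A \<omega> - v \<omega> * indicator A \<omega> \<partial>M) = 0"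
    using nn by (intro antisym Bochner_Integration.integral_nonneg)
  then have "AE \<omega> in M. u \<omega> * indicator A \<omega> - v \<omega> * indicator A \<omega> = 0"
    using integral_nonneg_eq_0_iff_AE[OF i'] nn by simp
  then show ?thesis
    using AE_space by eventually_elim (auto simp: A_def indicator_def split: if_splits)
qed

lemma AE_eq_if_integrals_eq:
  fixes u v :: "'a \<Rightarrow> real"
  assumes u: "integrable M u" and v: "integrable M v"
    and eq: "\<And>A. A \<in> sets M \<Longrightarrow> (\<integral>\<omega>. indicator A \<omega> * u \<omega> \<partial>M) = (\<integral>\<omega>. indicator A \<omega> * v \<omega> \<partial>M)"
  shows "AE \<omega> in M. u \<omega> = v \<omega>"
proof -
  have "AE \<omega> in M. u \<omega> \<le> v \<omega>" using eq by (intro AE_le_if_integrals_le u v) simp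
  moreover have "AE \<omega> in M. v \<omega> \<le> u \<omega>" using eq by (intro AE_le_if_integrals_le u v) simp
  ultimately show ?thesis by eventually_elim simp
qed

text \<open>
  The situation after scalarization by the multiplier \<open>\<zeta>\<close>: the linear functional \<open>l\<close> lies below the
  increments of the integral functional
  \<open>h \<mapsto> \<integral>\<omega>. \<zeta> \<omega> * F h \<omega> \<partial>M\<close>. Applied to \<open>x + restr A h\<close> this domination becomes local in \<open>\<omega>\<close>, which
  excludes singular functionals even when \<open>r = \<infinity>\<close>.
\<close>
locale dominated_functional = prob_space M for M :: "'a measure" +
  fixes r :: ennreal and f :: "'b::{banach, second_countable_topology} \<Rightarrow> 'a \<Rightarrow> real"
    and F :: "('a \<Rightarrow> 'b) \<Rightarrow> ('a \<Rightarrow> real)" and x :: "'a \<Rightarrow> 'b" and \<zeta> :: "'a \<Rightarrow> real"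
    and l :: "('a \<Rightarrow> 'b) \<Rightarrow> real"
  assumes x: "x \<in> Lp_space M r"
    and Ff: "\<And>h. h \<in> Lp_space M r \<Longrightarrow> AE \<omega> in M. F h \<omega> = f (h \<omega>) \<omega>"
    and f: "AE \<omega> in M. convex_on UNIV (\<lambda>y. f y \<omega>) \<and> continuous_on UNIV (\<lambda>y. f y \<omega>)"
    and \<zeta>: "\<And>\<omega>. 0 \<le> \<zeta> \<omega>"
    and integrable_increment: "\<And>h. h \<in> Lp_space M r \<Longrightarrow> integrable M (\<lambda>\<omega>. \<zeta> \<omega> * (F h \<omega> - F x \<omega>))"
    and lin: "linear l"
    and le: "\<And>h. h \<in> Lp_space M r \<Longrightarrow> l (h - x) \<le> (\<integral>\<omega>. \<zeta> \<omega> * (F h \<omega> - F x \<omega>) \<partial>M)"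
begin

sublocale l: linear l by (rule lin)

abbreviation X :: "('a \<Rightarrow> 'b) set" where "X \<equiv> Lp_space M r"

definition incr :: "('a \<Rightarrow> 'b) \<Rightarrow> 'a \<Rightarrow> real" where
  "incr h \<omega> = \<zeta> \<omega> * (F (x + h) \<omega> - F x \<omega>)"

definition restr :: "'a set \<Rightarrow> ('a \<Rightarrow> 'b) \<Rightarrow> 'a \<Rightarrow> 'b" where
  "restr A h \<omega> = indicator A \<omega> *\<^sub>R h \<omega>"

lemma subspace_X: "subspace X" by (rule subspace_Lp_space)

lemmas X_closed = x subspace_add[OF subspace_X] subspace_diff[OF subspace_X]
  subspace_scale[OF subspace_X] subspace_neg[OF subspace_X]

lemma const_X: "(\<lambda>\<omega>. y) \<in> X" by (rule Lp_space_const)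

lemma restr_X: "A \<in> events \<Longrightarrow> h \<in> X \<Longrightarrow> restr A h \<in> X"
  unfolding restr_def[abs_def] by (rule Lp_space_indicator_scaleR)

lemma restr_add: "restr A (h + k) = restr A h + restr A k"
  by (simp add: fun_eq_iff restr_def scaleR_add_right)

lemma restr_scale: "restr A (c *\<^sub>R h) = c *\<^sub>R restr A h"
  by (simp add: fun_eq_iff restr_def)

lemma restr_neg: "restr A (- h) = - restr A h"
  by (simp add: fun_eq_iff restr_def)

lemma restr_Un: "A \<inter> B = {} \<Longrightarrow> restr (A \<union> B) h = restr A h + restr B h"
  by (auto simp: fun_eq_iff restr_def indicator_def)

lemma incr_integrable: "h \<in> X \<Longrightarrow> integrable M (incr h)"
  unfolding incr_def[abs_def] by (intro integrable_increment X_closed)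

lemma incr_eq: "h \<in> X \<Longrightarrow> AE \<omega> in M. incr h \<omega> = \<zeta> \<omega> * (f (x \<omega> + h \<omega>) \<omega> - f (x \<omega>) \<omega>)"
  using Ff[OF X_closed(2)[OF x, of h]] Ff[OF x] by (auto simp: incr_def elim: eventually_elim2)

text \<open>
  The increment is local: almost surely, it vanishes where the perturbation does.
\<close>
lemma l_restr_le:
  assumes A: "A \<in> events" and h: "h \<in> X"
  shows "l (restr A h) \<le> (\<integral>\<omega>. indicator A \<omega> * incr h \<omega> \<partial>M)"
proof -
  have "AE \<omega> in M. incr (restr A h) \<omega> = indicator A \<omega> * incr h \<omega>"
    using incr_eq[OF h] incr_eq[OF restr_X[OF A h]]
    by eventually_elim (simp add: restr_def indicator_def)
  then have "(\<integral>\<omega>. incr (restr A h) \<omega> \<partial>M) = (\<integral>\<omega>. indicator A \<omega> * incr h \<omega> \<partial>M)"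
    using A incr_integrable[OF h] incr_integrable[OF restr_X[OF A h]] 
    by (intro integral_cong_AE) (auto dest!: borel_measurable_integrable)
  then show ?thesis
    using le[OF X_closed(2)[OF x restr_X[OF A h]]] by (simp add: incr_def)
qed

lemma l_AE_zero:
  assumes h: "h \<in> X" and h0: "AE \<omega> in M. h \<omega> = 0"
  shows "l h = 0"
proof -
  have *: "l k \<le> 0" if k: "k \<in> X" and k0: "AE \<omega> in M. k \<omega> = 0" for k
  proof -
    have "AE \<omega> in M. incr k \<omega> = 0" using incr_eq[OF k] k0 by eventually_elim simp
    then have "(\<integral>\<omega>. incr k \<omega> \<partial>M) = 0" by (rule integral_eq_zero_AE)
    then show ?thesis using le[OF X_closed(2)[OF x k]] by (simp add: incr_def)
  qed
  have "l (- h) \<le> 0" using h h0 by (intro * X_closed) auto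
  then show ?thesis using *[OF h h0] by (simp add: l.neg)
qed

text \<open>
  The signed set function \<open>A \<mapsto> l (restr A h)\<close> lies between the integrals over \<open>A\<close> of \<open>- incr (- h)\<close> and of
  \<open>incr h\<close>. Adding the integral of \<open>incr (- h)\<close> makes it nonnegative, and the upper bound by an integral
  makes it continuous at the empty set.
\<close>
lemma l_restr_density:
  assumes h: "h \<in> X"
  shows "\<exists>d. integrable M d \<and> (\<forall>A\<in>events. l (restr A h) = (\<integral>\<omega>. indicator A \<omega> * d \<omega> \<partial>M))"
proof -
  have nh: "- h \<in> X" by (intro X_closed h)
  define b where "b \<omega> = incr h \<omega> + incr (- h) \<omega>" for \<omega>
  have b: "integrable M b" unfolding b_def[abs_def]
    using incr_integrable[OF h] incr_integrable[OF nh] by (rule Bochner_Integration.integrable_add)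
  define \<mu> where "\<mu> A = l (restr A h) + (\<integral>\<omega>. indicator A \<omega> * incr (- h) \<omega> \<partial>M)" for A
  have i: "integrable M (\<lambda>\<omega>. indicator A \<omega> * k \<omega>)" if "A \<in> events" "integrable M k" for A and k :: "'a \<Rightarrow> real"
    using integrable_real_mult_indicator[OF that] by (simp add: mult.commute)
  have \<mu>0: "0 \<le> \<mu> A" if A: "A \<in> events" for A
    using l_restr_le[OF A nh] by (simp add: \<mu>_def restr_neg l.neg)
  have \<mu>b: "\<mu> A \<le> (\<integral>\<omega>. indicator A \<omega> * b \<omega> \<partial>M)" if A: "A \<in> events" for A
    using l_restr_le[OF A h] i[OF A incr_integrable[OF h]] i[OF A incr_integrable[OF nh]]
    by (simp add: \<mu>_def b_def distrib_left)
  obtain d where d: "integrable M d" "\<And>A. A \<in> events \<Longrightarrow> \<mu> A = (\<integral>\<omega>. indicator A \<omega> * d \<omega> \<partial>M)"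
  proof (rule finitely_additive_density[of \<mu>])
    fix A B assume AB: "A \<in> events" "B \<in> events" "A \<inter> B = {}"
    have "(\<integral>\<omega>. indicator (A \<union> B) \<omega> * incr (- h) \<omega> \<partial>M)
        = (\<integral>\<omega>. indicator A \<omega> * incr (- h) \<omega> + indicator B \<omega> * incr (- h) \<omega> \<partial>M)"
      using AB(3) by (intro Bochner_Integration.integral_cong) (auto simp: indicator_def)
    also have "\<dots> = (\<integral>\<omega>. indicator A \<omega> * incr (- h) \<omega> \<partial>M) + (\<integral>\<omega>. indicator B \<omega> * incr (- h) \<omega> \<partial>M)"
      using i[OF AB(1) incr_integrable[OF nh]] i[OF AB(2) incr_integrable[OF nh]]
      by (rule Bochner_Integration.integral_add)
    finally show "\<mu> (A \<union> B) = \<mu> A + \<mu> B" using AB(3) by (simp add: \<mu>_def restr_Un l.add)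
  next
    fix A assume A: "A \<in> null_sets M"
    then have "AE \<omega> in M. \<omega> \<notin> A" by (rule AE_not_in)
    then have "AE \<omega> in M. restr A h \<omega> = 0" "AE \<omega> in M. indicator A \<omega> * incr (- h) \<omega> = 0"
      by (eventually_elim, simp add: restr_def)+
    then show "\<mu> A = 0"
      using A l_AE_zero[of "restr A h"] by (simp add: \<mu>_def restr_X h integral_eq_zero_AE null_setsD2)
  next
    fix A :: "nat \<Rightarrow> 'a set" assume A: "range A \<subseteq> events" "decseq A" "(\<Inter>i. A i) = {}"
    then have [measurable]: "A i \<in> events" for i by auto
    note [measurable] = borel_measurable_integrable[OF b]
    have "(\<lambda>i. \<integral>\<omega>. indicator (A i) \<omega> * b \<omega> \<partial>M) \<longlonglongrightarrow> (\<integral>\<omega>. 0 \<partial>M)"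
    proof (rule integral_dominated_convergence[where w = "\<lambda>\<omega>. norm (b \<omega>)"])
      show "AE \<omega> in M. (\<lambda>i. indicator (A i) \<omega> * b \<omega>) \<longlonglongrightarrow> 0"
      proof (rule AE_I2)
        fix \<omega>
        obtain k where "\<omega> \<notin> A k" using A(3) by auto
        then have "\<forall>i\<ge>k. indicator (A i) \<omega> * b \<omega> = 0"
          using A(2) by (auto simp: decseq_def indicator_def)
        then show "(\<lambda>i. indicator (A i) \<omega> * b \<omega>) \<longlonglongrightarrow> 0"
          by (intro tendsto_eventually) (auto simp: eventually_sequentially)
      qed
    qed (use b in \<open>auto simp: indicator_def\<close>)
    then have lim: "(\<lambda>i. \<integral>\<omega>. indicator (A i) \<omega> * b \<omega> \<partial>M) \<longlonglongrightarrow> 0" by simp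
    show "(\<lambda>i. \<mu> (A i)) \<longlonglongrightarrow> 0"
      by (rule tendsto_sandwich[OF _ _ tendsto_const lim]) (auto intro!: always_eventually \<mu>0 \<mu>b)
  qed (use \<mu>0 in blast)+
  have "integrable M (\<lambda>\<omega>. d \<omega> - incr (- h) \<omega>)"
    using d(1) incr_integrable[OF nh] by (rule Bochner_Integration.integrable_diff)
  moreover have "l (restr A h) = (\<integral>\<omega>. indicator A \<omega> * (d \<omega> - incr (- h) \<omega>) \<partial>M)" if A: "A \<in> events" for A
    using d(2)[OF A] i[OF A d(1)] i[OF A incr_integrable[OF nh]]
    by (simp add: \<mu>_def right_diff_distrib)
  ultimately show ?thesis by blast
qed

definition dens :: "('a \<Rightarrow> 'b) \<Rightarrow> 'a \<Rightarrow> real" where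
  "dens h = (SOME d. integrable M d \<and> (\<forall>A\<in>events. l (restr A h) = (\<integral>\<omega>. indicator A \<omega> * d \<omega> \<partial>M)))"

lemma dens:
  assumes "h \<in> X"
  shows "integrable M (dens h)" "A \<in> events \<Longrightarrow> l (restr A h) = (\<integral>\<omega>. indicator A \<omega> * dens h \<omega> \<partial>M)"
  using someI_ex[OF l_restr_density[OF assms]] unfolding dens_def by auto

lemma l_eq_integral_dens:
  assumes h: "h \<in> X"
  shows "l h = (\<integral>\<omega>. dens h \<omega> \<partial>M)"
proof -
  have "l (h - restr (space M) h) = 0"
    using h by (intro l_AE_zero X_closed restr_X) (auto intro!: AE_I2 simp: restr_def)
  then have "l h = l (restr (space M) h)" by (simp add: l.diff)
  also have "\<dots> = (\<integral>\<omega>. indicator (space M) \<omega> * dens h \<omega> \<partial>M)" by (rule dens(2)[OF h]) simp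
  also have "\<dots> = (\<integral>\<omega>. dens h \<omega> \<partial>M)" by (intro Bochner_Integration.integral_cong) auto
  finally show ?thesis .
qed

lemma dens_le:
  assumes h: "h \<in> X"
  shows "AE \<omega> in M. dens h \<omega> \<le> incr h \<omega>"
  using dens[OF h] l_restr_le[OF _ h] incr_integrable[OF h]
  by (intro AE_le_if_integrals_le) simp_all

lemma dens_add:
  assumes h: "h \<in> X" and k: "k \<in> X"
  shows "AE \<omega> in M. dens (h + k) \<omega> = dens h \<omega> + dens k \<omega>"
proof (rule AE_eq_if_integrals_eq)
  have hk: "h + k \<in> X" by (intro X_closed h k)
  show "integrable M (dens (h + k))" by (rule dens(1)[OF hk])
  show "integrable M (\<lambda>\<omega>. dens h \<omega> + dens k \<omega>)" using dens(1)[OF h] dens(1)[OF k] by simp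
  fix A assume A: "A \<in> events"
  have i: "integrable M (\<lambda>\<omega>. indicator A \<omega> * dens h \<omega>)" "integrable M (\<lambda>\<omega>. indicator A \<omega> * dens k \<omega>)"
    using integrable_real_mult_indicator[OF A dens(1)[OF h]] integrable_real_mult_indicator[OF A dens(1)[OF k]]
    by (simp_all add: mult.commute)
  show "(\<integral>\<omega>. indicator A \<omega> * dens (h + k) \<omega> \<partial>M) = (\<integral>\<omega>. indicator A \<omega> * (dens h \<omega> + dens k \<omega>) \<partial>M)"
    using dens(2)[OF h A] dens(2)[OF k A] dens(2)[OF hk A] i
    by (simp add: restr_add l.add distrib_left)
qed

lemma dens_scale:
  assumes h: "h \<in> X"
  shows "AE \<omega> in M. dens (c *\<^sub>R h) \<omega> = c * dens h \<omega>"
proof (rule AE_eq_if_integrals_eq)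
  have ch: "c *\<^sub>R h \<in> X" by (intro X_closed h)
  show "integrable M (dens (c *\<^sub>R h))" by (rule dens(1)[OF ch])
  show "integrable M (\<lambda>\<omega>. c * dens h \<omega>)" using dens(1)[OF h] by simp
  fix A assume A: "A \<in> events"
  show "(\<integral>\<omega>. indicator A \<omega> * dens (c *\<^sub>R h) \<omega> \<partial>M) = (\<integral>\<omega>. indicator A \<omega> * (c * dens h \<omega>) \<partial>M)"
    using dens(2)[OF h A] dens(2)[OF ch A] by (simp add: restr_scale l.scale mult.left_commute)
qed

text \<open>
  On a countable dense rational subspace \<open>D\<close> the densities of the constant functions are, outside one
  null set, rational linear in \<open>d\<close> and bounded by the increment of \<open>f\<close>, so they extend to a functional
  \<open>g \<omega>\<close> in the dual space. For a general \<open>h\<close> and all \<open>d \<in> D\<close>, the density of \<open>h\<close> at \<open>\<omega>\<close> is at most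
  \<open>g \<omega> d + \<zeta> \<omega> * (f (x \<omega> + h \<omega> - d) \<omega> - f (x \<omega>) \<omega>)\<close>. Letting \<open>d\<close> tend to \<open>h \<omega>\<close> gives the upper bound
  \<open>g \<omega> (h \<omega>)\<close>, by continuity of \<open>f\<close>; the lower bound is the same statement for \<open>- h\<close>.
\<close>
lemma subgradient_selection:
  obtains g :: "'a \<Rightarrow> ('b \<Rightarrow>\<^sub>L real)" where "\<And>y. (\<lambda>\<omega>. blinfun_apply (g \<omega>) y) \<in> borel_measurable M"
    "AE \<omega> in M. \<forall>y. blinfun_apply (g \<omega>) y \<le> \<zeta> \<omega> * (f (x \<omega> + y) \<omega> - f (x \<omega>) \<omega>)"
    "\<And>h. h \<in> X \<Longrightarrow> AE \<omega> in M. dens h \<omega> = blinfun_apply (g \<omega>) (h \<omega>)"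
proof -
  obtain D :: "'b set" where D: "countable D" "closure D = UNIV" "\<And>d e. d \<in> D \<Longrightarrow> e \<in> D \<Longrightarrow> d + e \<in> D"
    "\<And>c d. c \<in> \<rat> \<Longrightarrow> d \<in> D \<Longrightarrow> c *\<^sub>R d \<in> D"
    using countable_dense_rational_subspace by metis
  define a where "a \<omega> y = \<zeta> \<omega> * (f (x \<omega> + y) \<omega> - f (x \<omega>) \<omega>)" for \<omega> y
  define u where "u \<omega> d = dens (\<lambda>_. d) \<omega>" for \<omega> d
  have a0: "a \<omega> 0 = 0" for \<omega> by (simp add: a_def)
  have acont: "AE \<omega> in M. continuous_on UNIV (a \<omega>)"
    using f
  proof eventually_elim
    fix \<omega> assume "convex_on UNIV (\<lambda>y. f y \<omega>) \<and> continuous_on UNIV (\<lambda>y. f y \<omega>)"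
    then have "continuous_on UNIV (\<lambda>y. f y \<omega>)" by simp
    then have "continuous_on UNIV (\<lambda>y. f (x \<omega> + y) \<omega>)"
      by (rule continuous_on_compose2) (auto intro!: continuous_intros)
    then show "continuous_on UNIV (a \<omega>)" unfolding a_def[abs_def] by (intro continuous_intros)
  qed
  have incr_a: "AE \<omega> in M. incr h \<omega> = a \<omega> (h \<omega>)" if "h \<in> X" for h
    using incr_eq[OF that] by (simp add: a_def)
  have "AE \<omega> in M. \<forall>d\<in>D. \<forall>e\<in>D. u \<omega> (d + e) = u \<omega> d + u \<omega> e"
    using D(1) dens_add[OF const_X const_X] by (simp add: AE_ball_countable u_def plus_fun_def)
  moreover have "AE \<omega> in M. \<forall>d\<in>D. \<forall>c\<in>\<rat>. u \<omega> (c *\<^sub>R d) = c * u \<omega> d"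
    using dens_scale[OF const_X]
    by (simp add: AE_ball_countable[OF D(1)] AE_ball_countable[OF countable_rat] u_def scaleR_fun_def)
  moreover have "AE \<omega> in M. \<forall>d\<in>D. u \<omega> d \<le> a \<omega> d"
    unfolding AE_ball_countable[OF D(1)]
  proof
    fix d show "AE \<omega> in M. u \<omega> d \<le> a \<omega> d"
      using dens_le[OF const_X, of d] incr_a[OF const_X, of d] by eventually_elim (simp add: u_def)
  qed
  moreover note acont
  ultimately have ext: "AE \<omega> in M. \<exists>v :: 'b \<Rightarrow>\<^sub>L real. \<forall>d\<in>D. blinfun_apply v d = u \<omega> d"
  proof eventually_elim
    fix \<omega> assume *: "\<forall>d\<in>D. \<forall>e\<in>D. u \<omega> (d + e) = u \<omega> d + u \<omega> e"
      "\<forall>d\<in>D. \<forall>c\<in>\<rat>. u \<omega> (c *\<^sub>R d) = c * u \<omega> d"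
      "\<forall>d\<in>D. u \<omega> d \<le> a \<omega> d" "continuous_on UNIV (a \<omega>)"
    show "\<exists>v :: 'b \<Rightarrow>\<^sub>L real. \<forall>d\<in>D. blinfun_apply v d = u \<omega> d"
    proof (rule rational_linear_extension[OF D(2-4), of "u \<omega>" "a \<omega>"])
      show "isCont (a \<omega>) 0" using *(4) by (simp add: continuous_on_eq_continuous_at)
    qed (use * a0 in auto)
  qed
  then obtain N where N: "N \<in> null_sets M"
    "\<And>\<omega>. \<omega> \<in> space M - N \<Longrightarrow> \<exists>v :: 'b \<Rightarrow>\<^sub>L real. \<forall>d\<in>D. blinfun_apply v d = u \<omega> d"
    by (auto elim!: AE_E3)
  then obtain v :: "'a \<Rightarrow> 'b \<Rightarrow>\<^sub>L real"
    where v: "\<And>\<omega> d. \<omega> \<in> space M - N \<Longrightarrow> d \<in> D \<Longrightarrow> blinfun_apply (v \<omega>) d = u \<omega> d"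
    by metis
  \<comment> \<open>The value \<open>0\<close> on \<open>N\<close> makes \<open>g\<close> measurable everywhere, also if \<open>M\<close> is not complete.\<close>
  define g where "g \<omega> = (if \<omega> \<in> space M - N then v \<omega> else 0)" for \<omega>
  have g_meas: "(\<lambda>\<omega>. blinfun_apply (g \<omega>) y) \<in> borel_measurable M" for y
  proof -
    obtain e where e: "\<And>n. e n \<in> D" "e \<longlonglongrightarrow> y"
      using D(2) closure_sequential[of y D] by auto
    have [measurable]: "space M - N \<in> events" using N by auto
    have [measurable]: "(\<lambda>\<omega>. u \<omega> (e n)) \<in> borel_measurable M" for n
      unfolding u_def using dens(1)[OF const_X] by (rule borel_measurable_integrable)
    show ?thesis
    proof (rule borel_measurable_LIMSEQ_real)
      show "(\<lambda>\<omega>. indicator (space M - N) \<omega> * u \<omega> (e n)) \<in> borel_measurable M" for n by measurable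
      fix \<omega>
      have "indicator (space M - N) \<omega> * u \<omega> (e n) = blinfun_apply (g \<omega>) (e n)" for n
        using v[OF _ e(1), of \<omega> n] by (simp add: g_def indicator_def blinfun.zero_left)
      then show "(\<lambda>n. indicator (space M - N) \<omega> * u \<omega> (e n)) \<longlonglongrightarrow> blinfun_apply (g \<omega>) y"
        using e(2) by (auto intro!: tendsto_intros)
    qed
  qed
  have gD: "AE \<omega> in M. \<forall>d\<in>D. blinfun_apply (g \<omega>) d = u \<omega> d"
    using AE_not_in[OF N(1)] AE_space by eventually_elim (simp add: g_def v)
  have dens_le_g: "AE \<omega> in M. dens h \<omega> \<le> blinfun_apply (g \<omega>) (h \<omega>)" if h: "h \<in> X" for h
  proof -
    have "AE \<omega> in M. dens h \<omega> \<le> u \<omega> d + a \<omega> (h \<omega> - d)" for d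
    proof -
      have hd: "h - (\<lambda>_. d) \<in> X" by (intro X_closed h const_X)
      have "AE \<omega> in M. dens ((h - (\<lambda>_. d)) + (\<lambda>_. d)) \<omega> = dens (h - (\<lambda>_. d)) \<omega> + u \<omega> d"
        using dens_add[OF hd const_X] by (simp only: u_def)
      then show ?thesis
        using dens_le[OF hd] incr_a[OF hd] by eventually_elim simp
    qed
    then have "AE \<omega> in M. \<forall>d\<in>D. dens h \<omega> \<le> u \<omega> d + a \<omega> (h \<omega> - d)"
      by (simp add: AE_ball_countable[OF D(1)])
    then show ?thesis
      using gD acont
    proof eventually_elim
      fix \<omega> assume *: "\<forall>d\<in>D. dens h \<omega> \<le> u \<omega> d + a \<omega> (h \<omega> - d)"
        "\<forall>d\<in>D. blinfun_apply (g \<omega>) d = u \<omega> d" "continuous_on UNIV (a \<omega>)"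
      have "continuous_on (closure D) (\<lambda>y. blinfun_apply (g \<omega>) y + a \<omega> (h \<omega> - y))"
        by (intro continuous_intros continuous_on_compose2[OF *(3)]) auto
      then have "dens h \<omega> \<le> blinfun_apply (g \<omega>) (h \<omega>) + a \<omega> (h \<omega> - h \<omega>)"
        by (rule continuous_ge_on_closure) (use * D(2) in auto)
      then show "dens h \<omega> \<le> blinfun_apply (g \<omega>) (h \<omega>)" by (simp add: a0)
    qed
  qed
  show ?thesis
  proof (rule that[of g])
    show "AE \<omega> in M. \<forall>y. blinfun_apply (g \<omega>) y \<le> \<zeta> \<omega> * (f (x \<omega> + y) \<omega> - f (x \<omega>) \<omega>)"
      using gD acont \<open>AE \<omega> in M. \<forall>d\<in>D. u \<omega> d \<le> a \<omega> d\<close>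
    proof eventually_elim
      fix \<omega> assume *: "\<forall>d\<in>D. blinfun_apply (g \<omega>) d = u \<omega> d" "continuous_on UNIV (a \<omega>)" "\<forall>d\<in>D. u \<omega> d \<le> a \<omega> d"
      have c: "continuous_on (closure D) (\<lambda>y. blinfun_apply (g \<omega>) y - a \<omega> y)"
        by (intro continuous_intros continuous_on_subset[OF *(2)]) auto
      have "blinfun_apply (g \<omega>) y - a \<omega> y \<le> 0" for y
        by (rule continuous_le_on_closure[OF c]) (use * D(2) in auto)
      then show "\<forall>y. blinfun_apply (g \<omega>) y \<le> \<zeta> \<omega> * (f (x \<omega> + y) \<omega> - f (x \<omega>) \<omega>)"
        by (simp add: a_def)
    qed
    fix h assume h: "h \<in> X"
    have "AE \<omega> in M. dens ((-1) *\<^sub>R h) \<omega> \<le> blinfun_apply (g \<omega>) (((-1) *\<^sub>R h) \<omega>)"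
      by (intro dens_le_g X_closed h)
    then show "AE \<omega> in M. dens h \<omega> = blinfun_apply (g \<omega>) (h \<omega>)"
      using dens_le_g[OF h] dens_scale[OF h, of "-1"]
      by eventually_elim (simp add: blinfun.minus_right)
  qed (rule g_meas)
qed

text \<open>
  Where \<open>\<zeta> \<omega> > 0\<close>, the functional \<open>g \<omega> / \<zeta> \<omega>\<close> is a subgradient of \<open>f\<close>. Where \<open>\<zeta> \<omega> = 0\<close>, the bound forces
  \<open>g \<omega> = 0\<close>, and it is enough that the subdifferential of \<open>f\<close> at \<open>x \<omega>\<close> is nonempty.
\<close>
theorem representation:
  assumes r: "1 \<le> r" "1 / r + 1 / s = 1"
  obtains g where "g \<in> Lp_space_dual_valued M s"
    "AE \<omega> in M. g \<omega> \<in> (\<lambda>v. \<zeta> \<omega> *\<^sub>R v) ` subdifferential (\<lambda>y. f y \<omega>) (x \<omega>)"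
    "\<And>h. h \<in> X \<Longrightarrow> l h = (\<integral>\<omega>. blinfun_apply (g \<omega>) (h \<omega>) \<partial>M)"
proof (rule subgradient_selection)
  fix g :: "'a \<Rightarrow> ('b \<Rightarrow>\<^sub>L real)" assume g: "\<And>y. (\<lambda>\<omega>. blinfun_apply (g \<omega>) y) \<in> borel_measurable M"
    and sub: "AE \<omega> in M. \<forall>y. blinfun_apply (g \<omega>) y \<le> \<zeta> \<omega> * (f (x \<omega> + y) \<omega> - f (x \<omega>) \<omega>)"
    and gd: "\<And>h. h \<in> X \<Longrightarrow> AE \<omega> in M. dens h \<omega> = blinfun_apply (g \<omega>) (h \<omega>)"
  have m: "(\<lambda>\<omega>. blinfun_apply (g \<omega>) (h \<omega>)) \<in> borel_measurable M" if "h \<in> X" for h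
    using borel_measurable_weakly_measurable_apply[OF g Lp_space_measurable[OF that]] .
  have i: "integrable M (\<lambda>\<omega>. blinfun_apply (g \<omega>) (h \<omega>))" if h: "h \<in> X" for h
    using integrable_cong_AE_imp[OF dens(1)[OF h] m[OF h]] gd[OF h] by simp
  have "g \<in> Lp_space_dual_valued M s" by (rule Lp_space_dual_valuedI[OF r g i])
  moreover have "AE \<omega> in M. g \<omega> \<in> (\<lambda>v. \<zeta> \<omega> *\<^sub>R v) ` subdifferential (\<lambda>y. f y \<omega>) (x \<omega>)"
    using sub f
  proof eventually_elim
    fix \<omega> assume le: "\<forall>y. blinfun_apply (g \<omega>) y \<le> \<zeta> \<omega> * (f (x \<omega> + y) \<omega> - f (x \<omega>) \<omega>)"
      and f: "convex_on UNIV (\<lambda>y. f y \<omega>) \<and> continuous_on UNIV (\<lambda>y. f y \<omega>)"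
    show "g \<omega> \<in> (\<lambda>v. \<zeta> \<omega> *\<^sub>R v) ` subdifferential (\<lambda>y. f y \<omega>) (x \<omega>)"
    proof (cases "\<zeta> \<omega> = 0")
      case True
      have "blinfun_apply (g \<omega>) y = 0" for y
        using le[rule_format, of y] le[rule_format, of "- y"] True by (simp add: blinfun.minus_right)
      then have "g \<omega> = 0" by (intro blinfun_eqI) simp
      moreover have "subdifferential (\<lambda>y. f y \<omega>) (x \<omega>) \<noteq> {}"
        using f by (intro subdifferential_nonempty) (auto simp: continuous_on_eq_continuous_at)
      ultimately show ?thesis using True by auto
    next
      case False
      then have pos: "0 < \<zeta> \<omega>" using \<zeta>[of \<omega>] by simp
      have "(1 / \<zeta> \<omega>) *\<^sub>R g \<omega> \<in> subdifferential (\<lambda>y. f y \<omega>) (x \<omega>)"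
        unfolding subdifferential_def
      proof (intro CollectI allI)
        fix z
        have "blinfun_apply (g \<omega>) (z - x \<omega>) \<le> \<zeta> \<omega> * (f z \<omega> - f (x \<omega>) \<omega>)"
          using le[rule_format, of "z - x \<omega>"] by simp
        then have "blinfun_apply (g \<omega>) (z - x \<omega>) / \<zeta> \<omega> \<le> f z \<omega> - f (x \<omega>) \<omega>"
          using pos by (simp add: pos_divide_le_eq mult.commute)
        then show "f (x \<omega>) \<omega> + blinfun_apply ((1 / \<zeta> \<omega>) *\<^sub>R g \<omega>) (z - x \<omega>) \<le> f z \<omega>"
          by (simp add: blinfun.scaleR_left)
      qed
      moreover have "g \<omega> = \<zeta> \<omega> *\<^sub>R ((1 / \<zeta> \<omega>) *\<^sub>R g \<omega>)" using pos by simp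
      ultimately show ?thesis by (rule rev_image_eqI)
    qed
  qed
  moreover have "l h = (\<integral>\<omega>. blinfun_apply (g \<omega>) (h \<omega>) \<partial>M)" if h: "h \<in> X" for h
    using l_eq_integral_dens[OF h] integral_cong_AE[OF borel_measurable_integrable[OF dens(1)[OF h]] m[OF h] gd[OF h]]
    by simp
  ultimately show ?thesis using that by blast
qed

end

section \<open>The subdifferential of the composition\<close>

text \<open>
  Lowering the argument by the indicator of \<open>{\<zeta> < 0}\<close> does not increase \<open>\<rho>\<close>, whereas the subgradient
  inequality would force a strict increase if that set had positive probability.
\<close>
lemma (in prob_space) pairing_subgradient_nonneg:
  assumes p: "1 \<le> p" "1 / p + 1 / q = 1" and Z: "Z \<in> Lp_space M p"
    and mono: "Lp_nondecreasing M p \<rho>" and \<zeta>: "\<zeta> \<in> Lp_subdifferential_pairing M p q \<rho> Z"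
  shows "AE \<omega> in M. 0 \<le> \<zeta> \<omega>"
proof -
  have \<zeta>q: "\<zeta> \<in> Lp_space M q"
    and sub: "\<And>V. V \<in> Lp_space M p \<Longrightarrow> \<rho> Z + (\<integral>\<omega>. \<zeta> \<omega> * (V \<omega> - Z \<omega>) \<partial>M) \<le> \<rho> V"
    using \<zeta> by (auto simp: Lp_subdifferential_pairing_def)
  note [measurable] = Lp_space_measurable[OF \<zeta>q]
  define A where "A = {\<omega>\<in>space M. \<zeta> \<omega> < 0}"
  have [measurable]: "A \<in> events" unfolding A_def by measurable
  have ind: "(indicator A :: 'a \<Rightarrow> real) \<in> Lp_space M p"
    by (rule Lp_space_bounded[of _ 1]) (auto simp: indicator_def)
  have V: "(\<lambda>\<omega>. Z \<omega> - indicator A \<omega>) \<in> Lp_space M p" by (rule Lp_space_diff[OF Z ind])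
  have i: "integrable M (\<lambda>\<omega>. \<zeta> \<omega> * indicator A \<omega>)"
    using integrable_product_conjugate[OF p ind \<zeta>q] by (simp add: mult.commute)
  have "\<rho> (\<lambda>\<omega>. Z \<omega> - indicator A \<omega>) \<le> \<rho> Z"
    using mono V Z by (auto simp: Lp_nondecreasing_def)
  then have "- (\<integral>\<omega>. \<zeta> \<omega> * indicator A \<omega> \<partial>M) \<le> 0" using sub[OF V] by simp
  moreover have nn: "0 \<le> - (\<zeta> \<omega> * indicator A \<omega>)" for \<omega> by (auto simp: A_def indicator_def)
  moreover have "0 \<le> (\<integral>\<omega>. - (\<zeta> \<omega> * indicator A \<omega>) \<partial>M)"
    using nn by (rule Bochner_Integration.integral_nonneg)
  ultimately have "(\<integral>\<omega>. - (\<zeta> \<omega> * indicator A \<omega>) \<partial>M) = 0" by simp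
  then have "AE \<omega> in M. - (\<zeta> \<omega> * indicator A \<omega>) = 0"
    using integral_nonneg_eq_0_iff_AE[of M "\<lambda>\<omega>. - (\<zeta> \<omega> * indicator A \<omega>)"] i nn by simp
  then show ?thesis
    using AE_space by eventually_elim (auto simp: A_def indicator_def not_less split: if_splits)
qed

text \<open>
  Multiplying the pointwise subgradient inequality of
  \<open>f\<close> by the nonnegative \<open>\<zeta>\<close> and integrating gives a lower bound for the
  integral in the subgradient inequality of \<open>\<rho>\<close>.
\<close>
lemma (in prob_space) pairing_product_subgradient:
  fixes f :: "'b::{banach, second_countable_topology} \<Rightarrow> 'a \<Rightarrow> real"
  assumes p: "1 \<le> p" "1 / p + 1 / q = 1" and r: "1 \<le> r" "1 / r + 1 / s = 1"
    and F: "\<And>h. h \<in> Lp_space M r \<Longrightarrow> F h \<in> Lp_space M p"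
    and Ff: "\<And>h. h \<in> Lp_space M r \<Longrightarrow> AE \<omega> in M. F h \<omega> = f (h \<omega>) \<omega>"
    and x: "x \<in> Lp_space M r" and mono: "Lp_nondecreasing M p \<rho>"
    and \<zeta>: "\<zeta> \<in> Lp_subdifferential_pairing M p q \<rho> (F x)"
    and g: "g \<in> Lp_space_dual_valued M s"
    and g\<zeta>: "AE \<omega> in M. g \<omega> \<in> (\<lambda>v. \<zeta> \<omega> *\<^sub>R v) ` subdifferential (\<lambda>y. f y \<omega>) (x \<omega>)"
  shows "Lp_functional M r g \<in> Lp_subdifferential M r (\<rho> \<circ> F) x"
  unfolding Lp_subdifferential_def
proof (intro CollectI conjI ballI)
  show "Lp_functional M r g \<in> Lp_dual M r" by (rule Lp_functional_in_dual[OF r g])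
  fix h :: "'a \<Rightarrow> 'b" assume h: "h \<in> Lp_space M r"
  have hx: "(\<lambda>\<omega>. h \<omega> - x \<omega>) \<in> Lp_space M r" by (rule Lp_space_diff[OF h x])
  have \<zeta>q: "\<zeta> \<in> Lp_space M q"
    and sub: "\<rho> (F x) + (\<integral>\<omega>. \<zeta> \<omega> * (F h \<omega> - F x \<omega>) \<partial>M) \<le> \<rho> (F h)"
    using \<zeta> F[OF h] by (auto simp: Lp_subdifferential_pairing_def)
  have i: "integrable M (\<lambda>\<omega>. \<zeta> \<omega> * (F h \<omega> - F x \<omega>))"
    using integrable_product_conjugate[OF p Lp_space_diff[OF F[OF h] F[OF x]] \<zeta>q] by (simp add: mult.commute)
  have le: "AE \<omega> in M. blinfun_apply (g \<omega>) (h \<omega> - x \<omega>) \<le> \<zeta> \<omega> * (F h \<omega> - F x \<omega>)"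
    using g\<zeta> Ff[OF h] Ff[OF x] pairing_subgradient_nonneg[OF p F[OF x] mono \<zeta>]
  proof eventually_elim
    fix \<omega> assume "g \<omega> \<in> (\<lambda>v. \<zeta> \<omega> *\<^sub>R v) ` subdifferential (\<lambda>y. f y \<omega>) (x \<omega>)"
      and F: "F h \<omega> = f (h \<omega>) \<omega>" "F x \<omega> = f (x \<omega>) \<omega>" and nn: "0 \<le> \<zeta> \<omega>"
    then obtain v where v: "g \<omega> = \<zeta> \<omega> *\<^sub>R v" "f (x \<omega>) \<omega> + blinfun_apply v (h \<omega> - x \<omega>) \<le> f (h \<omega>) \<omega>"
      by (auto simp: subdifferential_def)
    have "blinfun_apply v (h \<omega> - x \<omega>) \<le> F h \<omega> - F x \<omega>" using v(2) by (simp add: F)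
    then show "blinfun_apply (g \<omega>) (h \<omega> - x \<omega>) \<le> \<zeta> \<omega> * (F h \<omega> - F x \<omega>)"
      using nn by (simp add: v(1) blinfun.scaleR_left mult_left_mono)
  qed
  have "(\<integral>\<omega>. blinfun_apply (g \<omega>) (h \<omega> - x \<omega>) \<partial>M) \<le> (\<integral>\<omega>. \<zeta> \<omega> * (F h \<omega> - F x \<omega>) \<partial>M)"
    by (rule integral_mono_AE[OF Lp_space_dual_valued_integrable(1)[OF r g hx] i le])
  then show "(\<rho> \<circ> F) x + Lp_functional M r g (\<lambda>\<omega>. h \<omega> - x \<omega>) \<le> (\<rho> \<circ> F) h"
    using sub hx by (simp add: Lp_functional_def)
qed

lemma (in prob_space) superposition_convex:
  fixes f :: "'b::{banach, second_countable_topology} \<Rightarrow> 'a \<Rightarrow> real"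
  assumes f: "convex_integrand M f"
    and Ff: "\<And>h. h \<in> Lp_space M r \<Longrightarrow> AE \<omega> in M. F h \<omega> = f (h \<omega>) \<omega>"
    and h: "h \<in> Lp_space M r" and k: "k \<in> Lp_space M r" and t: "0 \<le> t" "t \<le> 1"
  shows "AE \<omega> in M. F ((1 - t) *\<^sub>R h + t *\<^sub>R k) \<omega> \<le> (1 - t) * F h \<omega> + t * F k \<omega>"
proof -
  have m: "(1 - t) *\<^sub>R h + t *\<^sub>R k \<in> Lp_space M r"
    using h k by (intro subspace_add[OF subspace_Lp_space] subspace_scale[OF subspace_Lp_space])
  have "AE \<omega> in M. convex_on UNIV (\<lambda>y. f y \<omega>)"
    using f unfolding convex_integrand_def by (auto elim: eventually_mono)
  then show ?thesis
    using Ff[OF h] Ff[OF k] Ff[OF m]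
  proof eventually_elim
    fix \<omega> assume c: "convex_on UNIV (\<lambda>y. f y \<omega>)"
      and F: "F h \<omega> = f (h \<omega>) \<omega>" "F k \<omega> = f (k \<omega>) \<omega>"
        "F ((1 - t) *\<^sub>R h + t *\<^sub>R k) \<omega> = f (((1 - t) *\<^sub>R h + t *\<^sub>R k) \<omega>) \<omega>"
    show "F ((1 - t) *\<^sub>R h + t *\<^sub>R k) \<omega> \<le> (1 - t) * F h \<omega> + t * F k \<omega>"
      using convex_onD[OF c t, of "h \<omega>" "k \<omega>"] unfolding F by simp
  qed
qed

theorem theorem2p2:
  fixes M :: "'a measure"
    and p q p' q' :: ennreal
    and f :: "'b::{banach, second_countable_topology} \<Rightarrow> 'a \<Rightarrow> real"
    and F :: "('a \<Rightarrow> 'b) \<Rightarrow> ('a \<Rightarrow> real)"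
    and \<rho> :: "('a \<Rightarrow> real) \<Rightarrow> real"
    and x :: "'a \<Rightarrow> 'b"
  assumes "prob_space M"
    and "1 \<le> p" and "p < \<infinity>" and "p \<le> p'"
    and "1 / p + 1 / q = 1" and "1 / p' + 1 / q' = 1"
    and "convex_integrand M f"
    and "\<And>h. h \<in> Lp_space M p' \<Longrightarrow> F h \<in> Lp_space M p"
    and "\<And>h. h \<in> Lp_space M p' \<Longrightarrow> (AE \<omega> in M. F h \<omega> = f (h \<omega>) \<omega>)"
    and "x \<in> Lp_space M p'"
    and "AE \<omega> in M. convex_on UNIV (\<lambda>y. f y \<omega>) \<and> isCont (\<lambda>y. f y \<omega>) (x \<omega>)"
    and "Lp_continuous_at M p' p F x"
    and "Lp_convex M p \<rho>"
    and "Lp_nondecreasing M p \<rho>"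
  shows "Lp_subdifferential M p' (\<rho> \<circ> F) x \<noteq> {} \<and>
         Lp_subdifferential M p' (\<rho> \<circ> F) x =
           (\<Union>\<zeta>\<in>Lp_subdifferential_pairing M p q \<rho> (F x).
              Lp_functional M p' `
                {g \<in> Lp_space_dual_valued M q'.
                   AE \<omega> in M. g \<omega> \<in> (\<lambda>v. \<zeta> \<omega> *\<^sub>R v) ` subdifferential (\<lambda>y. f y \<omega>) (x \<omega>)})"
proof -
  interpret prob_space M by fact
  note p = \<open>1 \<le> p\<close> \<open>p < \<infinity>\<close> \<open>1 / p + 1 / q = 1\<close>
  have r: "1 \<le> p'" "1 / p' + 1 / q' = 1" using assms(2,4,6) by auto
  note F = assms(8) and Ff = assms(9) and x = assms(10) and conv = assms(13) and mono = assms(14)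
  note f = \<open>convex_integrand M f\<close>
  let ?X = "Lp_space M p' :: ('a \<Rightarrow> 'b) set" and ?\<phi> = "\<rho> \<circ> F"
  let ?G = "\<lambda>\<zeta>. {g \<in> Lp_space_dual_valued M q'.
                   AE \<omega> in M. g \<omega> \<in> (\<lambda>v. \<zeta> \<omega> *\<^sub>R v) ` subdifferential (\<lambda>y. f y \<omega>) (x \<omega>)}"
  let ?R = "\<Union>\<zeta>\<in>Lp_subdifferential_pairing M p q \<rho> (F x). Lp_functional M p' ` ?G \<zeta>"
  have sX: "subspace ?X" by (rule subspace_Lp_space)
  have Fconv: "AE \<omega> in M. F ((1 - t) *\<^sub>R h + t *\<^sub>R k) \<omega> \<le> (1 - t) * F h \<omega> + t * F k \<omega>"
    if "h \<in> ?X" "k \<in> ?X" "0 \<le> t" "t \<le> 1" for h k t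
    using superposition_convex[OF f Ff that] .
  have f': "AE \<omega> in M. convex_on UNIV (\<lambda>y. f y \<omega>) \<and> continuous_on UNIV (\<lambda>y. f y \<omega>)"
    using f by (simp add: convex_integrand_def)
  have core: "\<exists>\<zeta>\<in>Lp_subdifferential_pairing M p q \<rho> (F x). \<exists>g\<in>?G \<zeta>.
      \<forall>h\<in>?X. l h = (\<integral>\<omega>. blinfun_apply (g \<omega>) (h \<omega>) \<partial>M)"
    if l: "linear l" and sub: "\<And>h. h \<in> ?X \<Longrightarrow> \<rho> (F x) + l (h - x) \<le> \<rho> (F h)" for l
  proof (rule monotone_composition_multiplier[OF p, of p' F \<rho> x l])
    fix \<zeta> assume \<zeta>_sub: "\<zeta> \<in> Lp_subdifferential_pairing M p q \<rho> (F x)" and nn: "\<And>\<omega>. 0 \<le> \<zeta> \<omega>"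
      and le: "\<And>h. h \<in> ?X \<Longrightarrow> l (h - x) \<le> (\<integral>\<omega>. \<zeta> \<omega> * (F h \<omega> - F x \<omega>) \<partial>M)"
    have \<zeta>q: "\<zeta> \<in> Lp_space M q" using \<zeta>_sub by (simp add: Lp_subdifferential_pairing_def)
    have i: "integrable M (\<lambda>\<omega>. \<zeta> \<omega> * (F h \<omega> - F x \<omega>))" if h: "h \<in> ?X" for h
      using integrable_product_conjugate[OF p(1,3) Lp_space_diff[OF F[OF h] F[OF x]] \<zeta>q]
      by (simp add: mult.commute)
    interpret dominated_functional M p' f F x \<zeta> l
      by unfold_locales (fact x Ff f' nn i le | simp add: linear_add[OF l] linear_scale[OF l])+
    show ?thesis
    proof (rule representation[OF r])
      fix g assume "g \<in> Lp_space_dual_valued M q'"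
        and "AE \<omega> in M. g \<omega> \<in> (\<lambda>v. \<zeta> \<omega> *\<^sub>R v) ` subdifferential (\<lambda>y. f y \<omega>) (x \<omega>)"
      then have g: "g \<in> ?G \<zeta>" by simp
      assume "\<And>h. h \<in> ?X \<Longrightarrow> l h = (\<integral>\<omega>. blinfun_apply (g \<omega>) (h \<omega>) \<partial>M)"
      then show ?thesis by (intro bexI[OF _ \<zeta>_sub] bexI[OF _ g] ballI)
    qed
  qed (fact F Fconv conv mono x l sub)+
  have supset: "?R \<subseteq> Lp_subdifferential M p' ?\<phi> x"
  proof
    fix L assume "L \<in> ?R"
    then obtain \<zeta> g where \<zeta>: "\<zeta> \<in> Lp_subdifferential_pairing M p q \<rho> (F x)"
      and g: "g \<in> ?G \<zeta>" and L: "L = Lp_functional M p' g" by blast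
    show "L \<in> Lp_subdifferential M p' ?\<phi> x"
      unfolding L using g by (intro pairing_product_subgradient[where f = f, OF p(1,3) r F Ff x mono \<zeta>]) simp_all
  qed
  have subset: "Lp_subdifferential M p' ?\<phi> x \<subseteq> ?R"
  proof
    fix L assume "L \<in> Lp_subdifferential M p' ?\<phi> x"
    then have L: "L \<in> Lp_dual M p'"
      and sub: "\<And>h. h \<in> ?X \<Longrightarrow> \<rho> (F x) + L (\<lambda>\<omega>. h \<omega> - x \<omega>) \<le> \<rho> (F h)"
      by (auto simp: Lp_subdifferential_def)
    obtain l where l: "linear l" "\<And>h. h \<in> ?X \<Longrightarrow> l h = L h"
    proof (rule linear_extension_from_subspace[OF sX, of L])
      show "L (h + k) = L h + L k" if "h \<in> ?X" "k \<in> ?X" for h k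
        using L that by (simp add: Lp_dual_def plus_fun_def)
      show "L (c *\<^sub>R h) = c * L h" if "h \<in> ?X" for c h
        using L that by (simp add: Lp_dual_def scaleR_fun_def)
    qed blast
    have "\<rho> (F x) + l (h - x) \<le> \<rho> (F h)" if h: "h \<in> ?X" for h
      using sub[OF h] l(2)[OF subspace_diff[OF sX h x]] by (simp add: fun_diff_def)
    from core[OF l(1) this] obtain \<zeta> g where \<zeta>: "\<zeta> \<in> Lp_subdifferential_pairing M p q \<rho> (F x)"
      and g: "g \<in> ?G \<zeta>" and rep: "\<And>h. h \<in> ?X \<Longrightarrow> l h = (\<integral>\<omega>. blinfun_apply (g \<omega>) (h \<omega>) \<partial>M)"
      by blast
    have "L \<in> extensional ?X" using L by (simp add: Lp_dual_def)
    then have "L = Lp_functional M p' g"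
      unfolding Lp_functional_def using rep l(2) by (intro extensionalityI[where A = ?X]) auto
    then show "L \<in> ?R" using \<zeta> g by blast
  qed
  \<comment> \<open>A linear support of the convex composition is bounded, since \<open>core\<close> represents it by an element
    of the right-hand side.\<close>
  have "convex_on ?X ?\<phi>"
  proof (rule convex_onI)
    fix t :: real and h k assume t: "0 < t" "t < 1" and h: "h \<in> ?X" and k: "k \<in> ?X"
    have "(1 - t) *\<^sub>R h + t *\<^sub>R k \<in> ?X"
      by (intro subspace_add[OF sX] subspace_scale[OF sX] h k)
    moreover have "(\<lambda>\<omega>. (1 - t) * F h \<omega> + t * F k \<omega>) \<in> Lp_space M p"
      by (intro Lp_space_add Lp_space_mult F h k)
    ultimately have "\<rho> (F ((1 - t) *\<^sub>R h + t *\<^sub>R k)) \<le> \<rho> (\<lambda>\<omega>. (1 - t) * F h \<omega> + t * F k \<omega>)"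
      using mono F Fconv[OF h k, of t] t by (simp add: Lp_nondecreasing_def)
    also have "\<dots> \<le> (1 - t) * \<rho> (F h) + t * \<rho> (F k)"
      using conv F[OF h] F[OF k] t by (simp add: Lp_convex_def)
    finally show "?\<phi> ((1 - t) *\<^sub>R h + t *\<^sub>R k) \<le> (1 - t) * ?\<phi> h + t * ?\<phi> k" by simp
  qed (rule subspace_imp_convex[OF sX])
  then obtain l where l: "linear l" "\<And>h. h \<in> ?X \<Longrightarrow> ?\<phi> x + l (h - x) \<le> ?\<phi> h"
    using convex_on_linear_support[OF _ sX x] by blast
  have "?R \<noteq> {}" using core[OF l(1)] l(2) by auto
  then show ?thesis using supset subset by auto
qed

end
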